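(* Fix $0<p<2$, $\eta>0$ and $n\ge1$. Then $\bar R_n^*(M_{n,p}(\eta))=\bar\rho_p(\eta)$.
   Context: Minimax-Bayes risk: $\bar R_n^*(M_{n,p}(\eta))=\inf_{\hat\mu}\sup_\pi\{\mathbb{E}_\pi\mathbb{E}_\mu[\frac1n\sum_{i=1}^n(\log\hat\mu_i-\log\mu_i)^2]:\ \mathbb{E}_\pi[\frac1n\sum_{i=1}^n\log^p\mu_i]\le\eta^p\}$, where $\pi$ ranges over distributions on $[1,\infty)^n$, given $\mu$ the data $X_1,\dots,X_n$ are independent with $X_i\sim\mathrm{Exp}(\mu_i)$ (mean $\mu_i$), and $\hat\mu$ ranges over estimators with values in $(0,\infty)^n$. Univariate minimax-Bayes risk: with $\mathcal F_p(\eta)$ the set of distributions $F$ on $[1,\infty)$ with $\int\log^p(\mu)\,dF(\mu)\le\eta^p$, a scalar $\mu\sim F$ and $X\mid\mu\sim\mathrm{Exp}(\mu)$, set $\bar\rho_p(\eta)=\inf_\delta\sup_{F\in\mathcal F_p(\eta)}\mathbb{E}_F\mathbb{E}_\mu(\log\delta(X)-\log\mu)^2$, infimum over measurable $\delta:[0,\infty)\to(0,\infty)$. *)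

theory Defs
  imports "HOL-Probability.Probability"
begin

text \<open>Law of the data X = (X_1,...,X_n) given mu: independent, X_i ~ Exp with MEAN mu_i
  (i.e. rate 1/mu_i).\<close>
definition exp_data :: "nat \<Rightarrow> (nat \<Rightarrow> real) \<Rightarrow> (nat \<Rightarrow> real) measure" where
  "exp_data n \<mu> = (\<Pi>\<^sub>M i\<in>{..<n}. density lborel (\<lambda>x. ennreal (exponential_density (1 / \<mu> i) x)))"

definition exp_law :: "real \<Rightarrow> real measure" where
  "exp_law \<mu> = density lborel (\<lambda>x. ennreal (exponential_density (1 / \<mu>) x))"

definition prior_class :: "nat \<Rightarrow> real \<Rightarrow> real \<Rightarrow> (nat \<Rightarrow> real) measure set" where
  "prior_class n p \<eta> = {\<pi>. prob_space \<pi> \<and>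
      sets \<pi> = sets (\<Pi>\<^sub>M i\<in>{..<n}. (borel :: real measure)) \<and>
      (AE \<mu> in \<pi>. \<forall>i<n. 1 \<le> \<mu> i) \<and>
      (\<integral>\<^sup>+ \<mu>. ennreal ((1 / real n) * (\<Sum>i<n. ln (\<mu> i) powr p)) \<partial>\<pi>) \<le> ennreal (\<eta> powr p)}"

definition estimators :: "nat \<Rightarrow> ((nat \<Rightarrow> real) \<Rightarrow> (nat \<Rightarrow> real)) set" where
  "estimators n = {\<delta>. (\<forall>i<n. (\<lambda>x. \<delta> x i) \<in> borel_measurable (\<Pi>\<^sub>M i\<in>{..<n}. (borel :: real measure)))
      \<and> (\<forall>x. \<forall>i<n. 0 < \<delta> x i)}"

definition bayes_risk :: "nat \<Rightarrow> ((nat \<Rightarrow> real) \<Rightarrow> (nat \<Rightarrow> real)) \<Rightarrow> (nat \<Rightarrow> real) measure \<Rightarrow> ennreal" where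
  "bayes_risk n \<delta> \<pi> = (\<integral>\<^sup>+ \<mu>. (\<integral>\<^sup>+ x. ennreal ((1 / real n) * (\<Sum>i<n. (ln (\<delta> x i) - ln (\<mu> i))\<^sup>2)) \<partial>exp_data n \<mu>) \<partial>\<pi>)"

definition minimax_bayes_risk :: "nat \<Rightarrow> real \<Rightarrow> real \<Rightarrow> ennreal" where
  "minimax_bayes_risk n p \<eta> = (INF \<delta>\<in>estimators n. SUP \<pi>\<in>prior_class n p \<eta>. bayes_risk n \<delta> \<pi>)"

definition prior_class1 :: "real \<Rightarrow> real \<Rightarrow> real measure set" where
  "prior_class1 p \<eta> = {F. prob_space F \<and> sets F = sets (borel :: real measure) \<and>
      (AE \<mu> in F. 1 \<le> \<mu>) \<and>
      (\<integral>\<^sup>+ \<mu>. ennreal (ln \<mu> powr p) \<partial>F) \<le> ennreal (\<eta> powr p)}"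

definition estimators1 :: "(real \<Rightarrow> real) set" where
  "estimators1 = {\<delta>. \<delta> \<in> borel_measurable borel \<and> (\<forall>x. 0 < \<delta> x)}"

definition bayes_risk1 :: "(real \<Rightarrow> real) \<Rightarrow> real measure \<Rightarrow> ennreal" where
  "bayes_risk1 \<delta> F = (\<integral>\<^sup>+ \<mu>. (\<integral>\<^sup>+ x. ennreal ((ln (\<delta> x) - ln \<mu>)\<^sup>2) \<partial>exp_law \<mu>) \<partial>F)"

definition rho_bar :: "real \<Rightarrow> real \<Rightarrow> ennreal" where
  "rho_bar p \<eta> = (INF \<delta>\<in>estimators1. SUP F\<in>prior_class1 p \<eta>. bayes_risk1 \<delta> F)"

end

theory Submission
  imports Defs
begin

text \<open>
  In terms of \<open>t = ln \<delta>\<close> the loss is quadratic. Let \<open>b(F)\<close> be the Bayes value of a univariate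
  prior \<open>F\<close> and \<open>V\<close> the supremum of \<open>b\<close> over the prior class. A coordinatewise rule has, under
  any prior on the mean vector, the univariate risk under the average of the marginals, so the
  multivariate value is at most the univariate one. Under a product prior, fixing the means and
  the data of the other coordinates leaves a univariate rule, so the multivariate value is at
  least \<open>V\<close>.

  It remains to find one rule whose risk is at most \<open>V\<close> for every prior. By the parallelogram
  identity two near-optimal rules for \<open>F\<close> are close in \<open>L\<^sup>2\<close> of the law of the data, and the
  moment constraint makes these laws dominate a common multiple of Exp(1). Passing through
  mixtures of two priors, all rules that are near-optimal for some prior with \<open>b(F)\<close> near \<open>V\<close>
  are therefore close in \<open>L\<^sup>2\<close>(Exp(1)), and such rules converge almost everywhere to a common
  limit \<open>\<tau>\<close>. For any prior \<open>G\<close>, mixing a small weight of \<open>G\<close> into such an \<open>F\<close> produces rules of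
  this kind whose risk at \<open>G\<close> hardly exceeds \<open>V\<close>; Fatou's lemma then bounds the risk of \<open>\<tau>\<close> at
  \<open>G\<close>.
\<close>

subsection \<open>Mixtures and products of measures\<close>

lemma measure_pmf_bind_in_prob_algebra:
  assumes "\<And>i. M i \<in> space (prob_algebra N)"
  shows "measure_pmf q \<bind> M \<in> space (prob_algebra N)"
proof -
  have "measure_pmf q \<in> space (prob_algebra (count_space UNIV))"
    by (simp add: space_prob_algebra prob_space_measure_pmf)
  moreover have "M \<in> count_space UNIV \<rightarrow>\<^sub>M prob_algebra N"
    using assms by simp
  ultimately show ?thesis
    unfolding space_prob_algebra[of N] by (auto intro: prob_space_bind' simp: sets_bind')
qed

lemma nn_integral_measure_pmf_bind:
  assumes "\<And>i. M i \<in> space (prob_algebra N)" "f \<in> borel_measurable N"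
  shows "(\<integral>\<^sup>+x. f x \<partial>(measure_pmf q \<bind> M)) = (\<integral>\<^sup>+i. \<integral>\<^sup>+x. f x \<partial>M i \<partial>measure_pmf q)"
  using assms
  by (intro nn_integral_bind)
    (auto simp: space_prob_algebra space_subprob_algebra prob_space_imp_subprob_space)

lemma AE_measure_pmf_bind_iff:
  assumes "\<And>i. M i \<in> space (prob_algebra N)" "Measurable.pred N P"
  shows "(AE x in measure_pmf q \<bind> M. P x) \<longleftrightarrow> (AE i in measure_pmf q. AE x in M i. P x)"
  using assms
  by (intro AE_bind) (auto simp: space_prob_algebra space_subprob_algebra prob_space_imp_subprob_space)

definition bernoulli_mixture :: "real \<Rightarrow> 'a measure \<Rightarrow> 'a measure \<Rightarrow> 'a measure" where
  "bernoulli_mixture l F G = measure_pmf (bernoulli_pmf l) \<bind> (\<lambda>b. if b then F else G)"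

lemma nn_integral_bernoulli_mixture:
  assumes "F \<in> space (prob_algebra N)" "G \<in> space (prob_algebra N)" "0 \<le> l" "l \<le> 1"
    and "f \<in> borel_measurable N"
  shows "(\<integral>\<^sup>+x. f x \<partial>bernoulli_mixture l F G)
    = ennreal l * (\<integral>\<^sup>+x. f x \<partial>F) + ennreal (1 - l) * (\<integral>\<^sup>+x. f x \<partial>G)"
  using assms unfolding bernoulli_mixture_def
  by (subst nn_integral_measure_pmf_bind[where N = N]) (simp_all add: mult.commute)

text \<open>
  The library states its product rules for families that are \<open>\<sigma>\<close>-finite at every index; extending by null
  measures makes them available when this is known on \<open>I\<close> only.
\<close>

lemma product_sigma_finite_null_extension:
  assumes "\<And>i. i \<in> I \<Longrightarrow> sigma_finite_measure (M i)"
  shows "product_sigma_finite (\<lambda>i. if i \<in> I then M i else null_measure (count_space UNIV))"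
  using assms
  by (auto simp: product_sigma_finite_def intro!: finite_measure.axioms(1)[OF finite_measureI])

lemma nn_integral_PiM_insert:
  assumes fin: "finite I" "i \<notin> I"
    and M: "\<And>j. j \<in> insert i I \<Longrightarrow> sigma_finite_measure (M j)"
    and f: "f \<in> borel_measurable (Pi\<^sub>M (insert i I) M)"
  shows "(\<integral>\<^sup>+x. f x \<partial>Pi\<^sub>M (insert i I) M) = (\<integral>\<^sup>+x. \<integral>\<^sup>+y. f (x(i := y)) \<partial>M i \<partial>Pi\<^sub>M I M)"
proof -
  let ?M = "\<lambda>j. if j \<in> insert i I then M j else null_measure (count_space UNIV)"
  interpret product_sigma_finite ?M
    by (rule product_sigma_finite_null_extension) (rule M)
  have "Pi\<^sub>M (insert i I) M = Pi\<^sub>M (insert i I) ?M" "Pi\<^sub>M I M = Pi\<^sub>M I ?M"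
    by (auto intro!: PiM_cong)
  then show ?thesis
    using product_nn_integral_insert[OF fin, of f] f by simp
qed

lemma emeasure_PiM_box:
  assumes I: "finite I"
    and M: "\<And>i. i \<in> I \<Longrightarrow> sigma_finite_measure (M i)"
    and A: "\<And>i. i \<in> I \<Longrightarrow> A i \<in> sets (M i)"
  shows "emeasure (Pi\<^sub>M I M) (Pi\<^sub>E I A) = (\<Prod>i\<in>I. emeasure (M i) (A i))"
proof -
  let ?M = "\<lambda>i. if i \<in> I then M i else null_measure (count_space UNIV)"
  interpret product_sigma_finite ?M
    by (rule product_sigma_finite_null_extension) (rule M)
  have "Pi\<^sub>M I M = Pi\<^sub>M I ?M"
    by (auto intro!: PiM_cong)
  then show ?thesis
    using emeasure_PiM[OF I, of A] A by simp
qed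

lemma subprob_space_PiM:
  assumes I: "finite I" and M: "\<And>i. i \<in> I \<Longrightarrow> subprob_space (M i)"
  shows "subprob_space (Pi\<^sub>M I M)"
proof
  have "emeasure (Pi\<^sub>M I M) (\<Pi>\<^sub>E i\<in>I. space (M i)) = (\<Prod>i\<in>I. emeasure (M i) (space (M i)))"
    using I M by (intro emeasure_PiM_box finite_measure.axioms(1) subprob_space.axioms(1)) auto
  then show "emeasure (Pi\<^sub>M I M) (space (Pi\<^sub>M I M)) \<le> 1"
    using M by (simp add: space_PiM prod_le_1 subprob_space.subprob_emeasure_le_1)
  show "space (Pi\<^sub>M I M) \<noteq> {}"
    using M by (simp add: space_PiM PiE_eq_empty_iff subprob_space.subprob_not_empty)
qed

lemma measurable_PiM_kernel:
  assumes I: "finite I" and K: "\<And>i. i \<in> I \<Longrightarrow> K i \<in> M i \<rightarrow>\<^sub>M subprob_algebra (N i)"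
  shows "(\<lambda>\<mu>. \<Pi>\<^sub>M i\<in>I. K i (\<mu> i)) \<in> Pi\<^sub>M I M \<rightarrow>\<^sub>M subprob_algebra (Pi\<^sub>M I N)"
proof (rule measurable_subprob_algebra_generated)
  let ?space = "Pi\<^sub>E I (\<lambda>i. space (N i))"
  let ?boxes = "{Pi\<^sub>E I A |A. \<forall>i\<in>I. A i \<in> sets (N i)}"
  let ?P = "\<lambda>\<mu>. \<Pi>\<^sub>M i\<in>I. K i (\<mu> i)"
  have subprob_factor: "subprob_space (K i (\<mu> i))" and sets_factor: "sets (K i (\<mu> i)) = sets (N i)"
    if "\<mu> \<in> space (Pi\<^sub>M I M)" "i \<in> I" for \<mu> i
    using that PiE_mem[of \<mu> I "\<lambda>i. space (M i)" i] subprob_space_kernel[OF K] sets_kernel[OF K]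
    by (simp_all add: space_PiM)
  have box: "emeasure (?P \<mu>) (Pi\<^sub>E I A) = (\<Prod>i\<in>I. emeasure (K i (\<mu> i)) (A i))"
    if "\<mu> \<in> space (Pi\<^sub>M I M)" "\<And>i. i \<in> I \<Longrightarrow> A i \<in> sets (N i)" for \<mu> A
    using that subprob_factor sets_factor
    by (intro emeasure_PiM_box I finite_measure.axioms(1) subprob_space.axioms(1)) auto
  show "sets (Pi\<^sub>M I N) = sigma_sets ?space ?boxes"
    unfolding sets_PiM prod_algebra_eq_finite[OF I] by (rule arg_cong) auto
  show "Int_stable ?boxes"
  proof (rule Int_stableI)
    fix a b assume "a \<in> ?boxes" "b \<in> ?boxes"
    then obtain A B where "a = Pi\<^sub>E I A" "b = Pi\<^sub>E I B" "\<forall>i\<in>I. A i \<in> sets (N i)" "\<forall>i\<in>I. B i \<in> sets (N i)"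
      by auto
    then show "a \<inter> b \<in> ?boxes"
      by (auto simp: PiE_Int intro!: exI[of _ "\<lambda>i. A i \<inter> B i"])
  qed
  show "?boxes \<subseteq> Pow ?space"
    by (auto simp: PiE_iff dest: sets.sets_into_space)
  show "sets (?P \<mu>) = sets (Pi\<^sub>M I N)" if "\<mu> \<in> space (Pi\<^sub>M I M)" for \<mu>
    using sets_factor[OF that] by (intro sets_PiM_cong) simp_all
  show "subprob_space (?P \<mu>)" if "\<mu> \<in> space (Pi\<^sub>M I M)" for \<mu>
    using subprob_factor[OF that] by (rule subprob_space_PiM[OF I])
  show kernel_box: "(\<lambda>\<mu>. emeasure (?P \<mu>) B) \<in> borel_measurable (Pi\<^sub>M I M)" if B: "B \<in> ?boxes" for B
  proof -
    from B obtain A where B_eq: "B = Pi\<^sub>E I A" and A: "\<And>i. i \<in> I \<Longrightarrow> A i \<in> sets (N i)" by auto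
    have "(\<lambda>\<mu>. \<Prod>i\<in>I. emeasure (K i (\<mu> i)) (A i)) \<in> borel_measurable (Pi\<^sub>M I M)"
      using A K
      by (intro borel_measurable_prod_ennreal measurable_compose[OF measurable_component_singleton]
          measurable_emeasure_kernel)
    then show ?thesis
      unfolding B_eq by (subst measurable_cong[OF box]) (use A in auto)
  qed
  show "(\<lambda>\<mu>. emeasure (?P \<mu>) ?space) \<in> borel_measurable (Pi\<^sub>M I M)"
    by (rule kernel_box) auto
qed

lemma nn_integral_PiM_component:
  assumes M: "\<And>j. j \<in> I \<Longrightarrow> prob_space (M j)" and i: "i \<in> I" and f: "f \<in> borel_measurable (M i)"
  shows "(\<integral>\<^sup>+x. f (x i) \<partial>Pi\<^sub>M I M) = (\<integral>\<^sup>+y. f y \<partial>M i)"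
proof -
  have "(\<integral>\<^sup>+y. f y \<partial>M i) = (\<integral>\<^sup>+y. f y \<partial>distr (Pi\<^sub>M I M) (M i) (\<lambda>x. x i))"
    by (simp only: distr_PiM_component[of I M i, OF M i])
  also have "\<dots> = (\<integral>\<^sup>+x. f (x i) \<partial>Pi\<^sub>M I M)"
    using i f by (intro nn_integral_distr) auto
  finally show ?thesis ..
qed

lemma measurable_PiM_coordinate:
  "(\<lambda>\<mu>. \<mu> i) \<in> (\<Pi>\<^sub>M i\<in>I. borel) \<rightarrow>\<^sub>M borel"
proof (cases "i \<in> I")
  case False
  then have "\<mu> i = undefined" if "\<mu> \<in> space (\<Pi>\<^sub>M i\<in>I. borel)" for \<mu>
    using that by (auto simp: space_PiM PiE_iff extensional_def)
  then show ?thesis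
    by (subst measurable_cong[where g = "\<lambda>_. undefined"]) auto
qed simp

lemma nn_integral_scaled_sum:
  fixes f :: "'i \<Rightarrow> 'a \<Rightarrow> real"
  assumes "0 \<le> c" "\<And>i. i \<in> I \<Longrightarrow> f i \<in> borel_measurable M" "\<And>i x. 0 \<le> f i x"
  shows "(\<integral>\<^sup>+x. ennreal (c * (\<Sum>i\<in>I. f i x)) \<partial>M) = ennreal c * (\<Sum>i\<in>I. \<integral>\<^sup>+x. ennreal (f i x) \<partial>M)"
proof -
  have "ennreal (c * (\<Sum>i\<in>I. f i x)) = ennreal c * (\<Sum>i\<in>I. ennreal (f i x))" for x
    using assms by (simp add: ennreal_mult sum_nonneg)
  then show ?thesis
    using assms by (simp add: nn_integral_cmult nn_integral_sum del: sum_ennreal)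
qed

subsection \<open>Convergence almost everywhere from square-integral bounds\<close>

definition sq_dist :: "'a measure \<Rightarrow> ('a \<Rightarrow> real) \<Rightarrow> ('a \<Rightarrow> real) \<Rightarrow> ennreal" where
  "sq_dist N s t = (\<integral>\<^sup>+x. ennreal ((s x - t x)\<^sup>2) \<partial>N)"

lemma sq_dist_triangle:
  assumes [measurable]: "s \<in> borel_measurable N" "t \<in> borel_measurable N" "u \<in> borel_measurable N"
  shows "sq_dist N s t \<le> 2 * sq_dist N s u + 2 * sq_dist N t u"
proof -
  have "ennreal ((s x - t x)\<^sup>2) \<le> 2 * ennreal ((s x - u x)\<^sup>2) + 2 * ennreal ((t x - u x)\<^sup>2)" for x
  proof -
    have "2 * (s x - u x)\<^sup>2 + 2 * (t x - u x)\<^sup>2 - (s x - t x)\<^sup>2 = (s x + t x - 2 * u x)\<^sup>2"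
      by (simp add: power2_eq_square algebra_simps)
    then have "(s x - t x)\<^sup>2 \<le> 2 * (s x - u x)\<^sup>2 + 2 * (t x - u x)\<^sup>2"
      using zero_le_power2[of "s x + t x - 2 * u x"] by linarith
    then have "ennreal ((s x - t x)\<^sup>2) \<le> ennreal (2 * (s x - u x)\<^sup>2 + 2 * (t x - u x)\<^sup>2)"
      by (rule ennreal_leI)
    then show ?thesis
      by (simp add: ennreal_mult)
  qed
  then have "sq_dist N s t \<le> (\<integral>\<^sup>+x. 2 * ennreal ((s x - u x)\<^sup>2) + 2 * ennreal ((t x - u x)\<^sup>2) \<partial>N)"
    unfolding sq_dist_def by (rule nn_integral_mono)
  also have "\<dots> = 2 * sq_dist N s u + 2 * sq_dist N t u"
    unfolding sq_dist_def by (simp add: nn_integral_add nn_integral_cmult)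
  finally show ?thesis .
qed

lemma scale_sq_dist_le:
  assumes "sets Q = sets N" "scale_measure c N \<le> Q"
    and [measurable]: "s \<in> borel_measurable N" "t \<in> borel_measurable N"
  shows "c * sq_dist N s t \<le> sq_dist Q s t"
proof -
  have "c * sq_dist N s t = sq_dist (scale_measure c N) s t"
    unfolding sq_dist_def by (rule nn_integral_scale_measure[symmetric]) measurable
  also have "\<dots> \<le> sq_dist Q s t"
    unfolding sq_dist_def using assms by (intro nn_integral_mono_measure) auto
  finally show ?thesis .
qed

lemma AE_summable_of_nn_integral_le:
  fixes f :: "nat \<Rightarrow> 'a \<Rightarrow> real"
  assumes [measurable]: "\<And>k. f k \<in> borel_measurable N"
    and nonneg: "\<And>k x. 0 \<le> f k x" "\<And>k. 0 \<le> a k"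
    and integral_le: "\<And>k. (\<integral>\<^sup>+x. ennreal (f k x) \<partial>N) \<le> ennreal (a k)"
    and a: "summable a"
  shows "AE x in N. summable (\<lambda>k. f k x)"
proof -
  have "(\<integral>\<^sup>+x. (\<Sum>k. ennreal (f k x)) \<partial>N) = (\<Sum>k. \<integral>\<^sup>+x. ennreal (f k x) \<partial>N)"
    by (rule nn_integral_suminf) measurable
  also have "\<dots> \<le> (\<Sum>k. ennreal (a k))"
    by (intro suminf_le integral_le) auto
  also have "\<dots> = ennreal (suminf a)"
    using a nonneg(2) by (simp add: suminf_ennreal2)
  finally have "(\<integral>\<^sup>+x. (\<Sum>k. ennreal (f k x)) \<partial>N) \<noteq> \<infinity>"
    by (metis ennreal_less_top infinity_ennreal_def leD)
  then have "AE x in N. (\<Sum>k. ennreal (f k x)) \<noteq> \<infinity>"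
    by (intro nn_integral_PInf_AE) measurable
  then show ?thesis
    by eventually_elim (use nonneg(1) in \<open>auto intro: summable_suminf_not_top\<close>)
qed

lemma AE_summable_diff_of_sq_dist_le:
  assumes [measurable]: "\<And>k. s k \<in> borel_measurable N" "\<And>k. t k \<in> borel_measurable N"
    and C: "0 \<le> C" and dist_le: "\<And>k. sq_dist N (s k) (t k) \<le> ennreal (C * (1 / 4) ^ k)"
  shows "AE x in N. summable (\<lambda>k. s k x - t k x)"
proof -
  have "AE x in N. summable (\<lambda>k. 2 ^ k * (s k x - t k x)\<^sup>2)"
  proof (rule AE_summable_of_nn_integral_le)
    fix k
    have "(\<integral>\<^sup>+x. ennreal (2 ^ k * (s k x - t k x)\<^sup>2) \<partial>N) = ennreal (2 ^ k) * sq_dist N (s k) (t k)"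
      unfolding sq_dist_def by (subst nn_integral_cmult[symmetric]) (auto simp: ennreal_mult)
    also have "\<dots> \<le> ennreal (2 ^ k) * ennreal (C * (1 / 4) ^ k)"
      by (intro mult_left_mono dist_le) simp
    also have "\<dots> = ennreal (C * (2 * (1 / 4)) ^ k)"
      using C by (simp add: ennreal_mult[symmetric] power_mult_distrib mult.left_commute
          del: times_divide_eq_right)
    finally show "(\<integral>\<^sup>+x. ennreal (2 ^ k * (s k x - t k x)\<^sup>2) \<partial>N) \<le> ennreal (C * (1 / 2) ^ k)"
      by simp
  qed (use C in \<open>auto intro!: summable_mult summable_geometric\<close>)
  then show ?thesis
  proof eventually_elim
    case (elim x)
    define d where "d k = s k x - t k x" for k
    have AM_GM: "norm (d k) \<le> 2 ^ k * (d k)\<^sup>2 + (1 / 2) ^ k" for k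
    proof -
      have "0 \<le> (2 ^ k * \<bar>d k\<bar> - 1)\<^sup>2" by simp
      then have "2 * (2 ^ k * \<bar>d k\<bar>) \<le> (2 ^ k)\<^sup>2 * (d k)\<^sup>2 + 1"
        by (simp add: power2_diff power_mult_distrib)
      then have "2 * \<bar>d k\<bar> \<le> 2 ^ k * (d k)\<^sup>2 + (1 / 2) ^ k"
        by (simp add: field_simps power2_eq_square)
      then show ?thesis by simp
    qed
    have "summable (\<lambda>k. 2 ^ k * (d k)\<^sup>2 + (1 / 2) ^ k)"
      using elim unfolding d_def by (intro summable_add summable_geometric) auto
    then have "summable d"
      by (rule summable_comparison_test'[where N = 0]) (rule AM_GM)
    then show ?case
      by (simp add: d_def[abs_def])
  qed
qed

lemma AE_convergent_of_sq_dist_le: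
  assumes "\<And>k. t k \<in> borel_measurable N"
    and "0 \<le> C" "\<And>k. sq_dist N (t (Suc k)) (t k) \<le> ennreal (C * (1 / 4) ^ k)"
  shows "AE x in N. convergent (\<lambda>k. t k x)"
proof -
  have "AE x in N. summable (\<lambda>k. t (Suc k) x - t k x)"
    using assms by (intro AE_summable_diff_of_sq_dist_le)
  then show ?thesis
  proof eventually_elim
    case (elim x)
    then have "convergent (\<lambda>n. t n x - t 0 x)"
      by (simp add: summable_iff_convergent sum_lessThan_telescope[where f = "\<lambda>k. t k x"])
    then show ?case
      by (simp add: convergent_diff_const_right_iff)
  qed
qed

subsection \<open>Bayes estimation under squared error\<close>

locale bayes_estimation =
  fixes M :: "'m measure" and N :: "'x measure" and K :: "'m \<Rightarrow> 'x measure" and g :: "'m \<Rightarrow> real"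
  assumes kernel: "K \<in> M \<rightarrow>\<^sub>M subprob_algebra N"
    and measurable_estimand [measurable]: "g \<in> borel_measurable M"
begin

definition sq_risk :: "('x \<Rightarrow> real) \<Rightarrow> 'm measure \<Rightarrow> ennreal" where
  "sq_risk t F = (\<integral>\<^sup>+m. \<integral>\<^sup>+x. ennreal ((t x - g m)\<^sup>2) \<partial>K m \<partial>F)"

definition bayes_value :: "'m measure \<Rightarrow> ennreal" where
  "bayes_value F = (INF t\<in>borel_measurable N. sq_risk t F)"

lemma bayes_value_le: "t \<in> borel_measurable N \<Longrightarrow> bayes_value F \<le> sq_risk t F"
  unfolding bayes_value_def by (rule INF_lower)

lemma measurable_kernel_prior: "sets F = sets M \<Longrightarrow> K \<in> F \<rightarrow>\<^sub>M subprob_algebra N"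
  using kernel by (simp cong: measurable_cong_sets)

lemma measurable_kernel_integral [measurable (raw)]:
  assumes f [measurable]: "(\<lambda>(w, x). f w x) \<in> borel_measurable (L \<Otimes>\<^sub>M N)"
    and h: "h \<in> L \<rightarrow>\<^sub>M M"
  shows "(\<lambda>w. \<integral>\<^sup>+x. f w x \<partial>K (h w)) \<in> borel_measurable L"
  by (rule nn_integral_measurable_subprob_algebra2[OF f measurable_compose[OF h kernel]])

lemma borel_measurable_kernel_eq: "m \<in> space M \<Longrightarrow> borel_measurable (K m) = borel_measurable N"
  using sets_kernel[OF kernel] by (intro measurable_cong_sets) auto

lemma sq_dist_bind:
  assumes F: "sets F = sets M" and [measurable]: "s \<in> borel_measurable N" "t \<in> borel_measurable N"
  shows "sq_dist (F \<bind> K) s t = (\<integral>\<^sup>+m. \<integral>\<^sup>+x. ennreal ((s x - t x)\<^sup>2) \<partial>K m \<partial>F)"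
  unfolding sq_dist_def by (rule nn_integral_bind[OF _ measurable_kernel_prior[OF F]]) measurable

lemma sq_risk_parallelogram:
  assumes F [measurable_cong]: "sets F = sets M"
    and [measurable]: "s \<in> borel_measurable N" "t \<in> borel_measurable N"
  shows "4 * sq_risk (\<lambda>x. (s x + t x) / 2) F + sq_dist (F \<bind> K) s t = 2 * sq_risk s F + 2 * sq_risk t F"
proof -
  have pointwise: "4 * ennreal (((a + b) / 2 - c)\<^sup>2) + ennreal ((a - b)\<^sup>2)
      = 2 * ennreal ((a - c)\<^sup>2) + 2 * ennreal ((b - c)\<^sup>2)" for a b c :: real
  proof -
    have "4 * ((a + b) / 2 - c)\<^sup>2 + (a - b)\<^sup>2 = 2 * (a - c)\<^sup>2 + 2 * (b - c)\<^sup>2"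
      by (simp add: power2_eq_square field_simps)
    then have "ennreal (4 * ((a + b) / 2 - c)\<^sup>2 + (a - b)\<^sup>2) = ennreal (2 * (a - c)\<^sup>2 + 2 * (b - c)\<^sup>2)"
      by simp
    then show ?thesis
      by (simp add: ennreal_mult)
  qed
  have conditional: "4 * (\<integral>\<^sup>+x. ennreal (((s x + t x) / 2 - g m)\<^sup>2) \<partial>K m)
        + (\<integral>\<^sup>+x. ennreal ((s x - t x)\<^sup>2) \<partial>K m)
      = 2 * (\<integral>\<^sup>+x. ennreal ((s x - g m)\<^sup>2) \<partial>K m) + 2 * (\<integral>\<^sup>+x. ennreal ((t x - g m)\<^sup>2) \<partial>K m)"
    if "m \<in> space M" for m
  proof -
    have [measurable]: "s \<in> borel_measurable (K m)" "t \<in> borel_measurable (K m)"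
      using that by (simp_all add: borel_measurable_kernel_eq)
    show ?thesis
      by (simp add: nn_integral_add[symmetric] nn_integral_cmult[symmetric] pointwise)
  qed
  have "4 * sq_risk (\<lambda>x. (s x + t x) / 2) F + sq_dist (F \<bind> K) s t
      = (\<integral>\<^sup>+m. 4 * (\<integral>\<^sup>+x. ennreal (((s x + t x) / 2 - g m)\<^sup>2) \<partial>K m)
          + (\<integral>\<^sup>+x. ennreal ((s x - t x)\<^sup>2) \<partial>K m) \<partial>F)"
    unfolding sq_risk_def by (simp add: sq_dist_bind[OF F] nn_integral_add nn_integral_cmult)
  also have "\<dots> = (\<integral>\<^sup>+m. 2 * (\<integral>\<^sup>+x. ennreal ((s x - g m)\<^sup>2) \<partial>K m)
      + 2 * (\<integral>\<^sup>+x. ennreal ((t x - g m)\<^sup>2) \<partial>K m) \<partial>F)"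
    using sets_eq_imp_space_eq[OF F] by (intro nn_integral_cong conditional) simp
  also have "\<dots> = 2 * sq_risk s F + 2 * sq_risk t F"
    unfolding sq_risk_def by (simp add: nn_integral_add nn_integral_cmult)
  finally show ?thesis .
qed

lemma near_bayes_rules_close:
  assumes F: "sets F = sets M"
    and st: "s \<in> borel_measurable N" "t \<in> borel_measurable N"
    and nonneg: "0 \<le> \<epsilon>" "0 \<le> a" "0 \<le> b" and V: "V < \<top>"
    and lower: "V \<le> bayes_value F + ennreal \<epsilon>"
    and s: "sq_risk s F \<le> V + ennreal a" and t: "sq_risk t F \<le> V + ennreal b"
  shows "sq_dist (F \<bind> K) s t \<le> ennreal (2 * a + 2 * b + 4 * \<epsilon>)"
proof -
  let ?mid = "sq_risk (\<lambda>x. (s x + t x) / 2) F"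
  have "bayes_value F \<le> ?mid"
    using st by (intro bayes_value_le) simp
  with lower have mid: "V \<le> ?mid + ennreal \<epsilon>"
    by (meson add_right_mono order_trans)
  have "4 * ?mid + sq_dist (F \<bind> K) s t \<le> 2 * (V + ennreal a) + 2 * (V + ennreal b)"
    unfolding sq_risk_parallelogram[OF F st] by (intro add_mono mult_left_mono s t) auto
  also have "\<dots> = (2 * V + 2 * V) + ennreal (2 * a + 2 * b)"
    using nonneg by (simp add: distrib_left ennreal_mult ac_simps)
  also have "2 * V + 2 * V = 4 * V"
    by (simp flip: distrib_right)
  finally have doubled: "4 * ?mid + sq_dist (F \<bind> K) s t \<le> 4 * V + ennreal (2 * a + 2 * b)" .
  also have "\<dots> \<le> 4 * (?mid + ennreal \<epsilon>) + ennreal (2 * a + 2 * b)"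
    by (intro add_right_mono mult_left_mono mid) simp
  also have "\<dots> = 4 * ?mid + ennreal (2 * a + 2 * b + 4 * \<epsilon>)"
    using nonneg by (simp add: distrib_left ennreal_mult ac_simps)
  finally have uncancelled: "4 * ?mid + sq_dist (F \<bind> K) s t \<le> 4 * ?mid + ennreal (2 * a + 2 * b + 4 * \<epsilon>)" .
  have "4 * ?mid + sq_dist (F \<bind> K) s t < \<top>"
    using doubled by (rule order.strict_trans1) (use V in \<open>simp add: ennreal_mult_less_top\<close>)
  then show ?thesis
    using uncancelled by (auto simp: ennreal_add_left_cancel_le)
qed

lemma sq_risk_bernoulli_mixture:
  assumes "F \<in> space (prob_algebra M)" "G \<in> space (prob_algebra M)" "0 \<le> l" "l \<le> 1"
    and [measurable]: "t \<in> borel_measurable N"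
  shows "sq_risk t (bernoulli_mixture l F G) = ennreal l * sq_risk t F + ennreal (1 - l) * sq_risk t G"
  unfolding sq_risk_def by (rule nn_integral_bernoulli_mixture[OF assms(1-4)]) measurable

lemma sq_risk_le_liminf:
  fixes s :: "nat \<Rightarrow> 'x \<Rightarrow> real"
  assumes F [measurable_cong]: "sets F = sets M"
    and s [measurable]: "\<And>k. s k \<in> borel_measurable N"
    and ac: "\<And>m. m \<in> space M \<Longrightarrow> absolutely_continuous N (K m)"
    and lim: "AE x in N. (\<lambda>k. s k x) \<longlonglongrightarrow> t x"
  shows "sq_risk t F \<le> liminf (\<lambda>k. sq_risk (s k) F)"
proof -
  have conditional: "(\<integral>\<^sup>+x. ennreal ((t x - g m)\<^sup>2) \<partial>K m)
      \<le> liminf (\<lambda>k. \<integral>\<^sup>+x. ennreal ((s k x - g m)\<^sup>2) \<partial>K m)" if m: "m \<in> space M" for m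
  proof -
    have [measurable]: "s k \<in> borel_measurable (K m)" for k
      using m by (simp add: borel_measurable_kernel_eq)
    have "AE x in K m. (\<lambda>k. s k x) \<longlonglongrightarrow> t x"
      using absolutely_continuous_AE[OF sets_kernel[OF kernel m] ac[OF m] lim] .
    then have "(\<integral>\<^sup>+x. ennreal ((t x - g m)\<^sup>2) \<partial>K m)
        \<le> (\<integral>\<^sup>+x. liminf (\<lambda>k. ennreal ((s k x - g m)\<^sup>2)) \<partial>K m)"
    proof (intro nn_integral_mono_AE, eventually_elim)
      case (elim x)
      then have "liminf (\<lambda>k. ennreal ((s k x - g m)\<^sup>2)) = ennreal ((t x - g m)\<^sup>2)"
        by (intro lim_imp_Liminf sequentially_bot tendsto_ennrealI tendsto_intros)
      then show ?case by simp
    qed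
    also have "\<dots> \<le> liminf (\<lambda>k. \<integral>\<^sup>+x. ennreal ((s k x - g m)\<^sup>2) \<partial>K m)"
      by (rule nn_integral_liminf) measurable
    finally show ?thesis .
  qed
  have "sq_risk t F \<le> (\<integral>\<^sup>+m. liminf (\<lambda>k. \<integral>\<^sup>+x. ennreal ((s k x - g m)\<^sup>2) \<partial>K m) \<partial>F)"
    unfolding sq_risk_def using sets_eq_imp_space_eq[OF F] by (intro nn_integral_mono conditional) simp
  also have "\<dots> \<le> liminf (\<lambda>k. sq_risk (s k) F)"
    unfolding sq_risk_def by (rule nn_integral_liminf) measurable
  finally show ?thesis .
qed

subsection \<open>Independent copies of an estimation problem\<close>

definition component_risk :: "'i set \<Rightarrow> 'i \<Rightarrow> (('i \<Rightarrow> 'x) \<Rightarrow> real) \<Rightarrow> ('i \<Rightarrow> 'm) measure \<Rightarrow> ennreal" where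
  "component_risk I i T \<pi> = (\<integral>\<^sup>+\<mu>. \<integral>\<^sup>+x. ennreal ((T x - g (\<mu> i))\<^sup>2) \<partial>(\<Pi>\<^sub>M j\<in>I. K (\<mu> j)) \<partial>\<pi>)"

lemma measurable_product_kernel:
  assumes "finite I" and \<pi>: "sets \<pi> = sets (\<Pi>\<^sub>M j\<in>I. M)"
  shows "(\<lambda>\<mu>. \<Pi>\<^sub>M j\<in>I. K (\<mu> j)) \<in> \<pi> \<rightarrow>\<^sub>M subprob_algebra (\<Pi>\<^sub>M j\<in>I. N)"
  unfolding measurable_cong_sets[OF \<pi> refl] using assms(1) kernel by (rule measurable_PiM_kernel)

lemma measurable_conditional_component_risk:
  assumes I: "finite I" "i \<in> I" and \<pi> [measurable_cong]: "sets \<pi> = sets (\<Pi>\<^sub>M j\<in>I. M)"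
    and [measurable]: "T \<in> borel_measurable (\<Pi>\<^sub>M j\<in>I. N)"
  shows "(\<lambda>\<mu>. \<integral>\<^sup>+x. ennreal ((T x - g (\<mu> i))\<^sup>2) \<partial>(\<Pi>\<^sub>M j\<in>I. K (\<mu> j))) \<in> borel_measurable \<pi>"
  using I
  by (intro nn_integral_measurable_subprob_algebra2[OF _ measurable_product_kernel[OF _ \<pi>]]) measurable

lemma component_risk_coordinate:
  assumes "finite I" and i: "i \<in> I" and \<pi>: "sets \<pi> = sets (\<Pi>\<^sub>M j\<in>I. M)"
    and markov: "AE \<mu> in \<pi>. \<forall>j\<in>I. prob_space (K (\<mu> j))" and t: "t \<in> borel_measurable N"
  shows "component_risk I i (\<lambda>x. t (x i)) \<pi> = (\<integral>\<^sup>+\<mu>. \<integral>\<^sup>+y. ennreal ((t y - g (\<mu> i))\<^sup>2) \<partial>K (\<mu> i) \<partial>\<pi>)"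
  unfolding component_risk_def
proof (rule nn_integral_cong_AE)
  show "AE \<mu> in \<pi>. (\<integral>\<^sup>+x. ennreal ((t (x i) - g (\<mu> i))\<^sup>2) \<partial>(\<Pi>\<^sub>M j\<in>I. K (\<mu> j)))
      = (\<integral>\<^sup>+y. ennreal ((t y - g (\<mu> i))\<^sup>2) \<partial>K (\<mu> i))"
    using markov AE_space
  proof eventually_elim
    case (elim \<mu>)
    have "\<mu> i \<in> space M"
      using elim(2) i sets_eq_imp_space_eq[OF \<pi>] by (auto simp: space_PiM)
    then have [measurable]: "t \<in> borel_measurable (K (\<mu> i))"
      using t by (simp add: borel_measurable_kernel_eq)
    show ?case
      using elim(1) i
      by (intro nn_integral_PiM_component[where f = "\<lambda>y. ennreal ((t y - g (\<mu> i))\<^sup>2)"]) auto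
  qed
qed

lemma nn_integral_product_kernel_insert:
  assumes J: "finite J" "i \<notin> J" and \<mu>: "\<mu> \<in> space (\<Pi>\<^sub>M j\<in>J. M)" and m: "m \<in> space M"
    and f: "f \<in> borel_measurable (\<Pi>\<^sub>M j\<in>insert i J. N)"
  shows "(\<integral>\<^sup>+x. f x \<partial>(\<Pi>\<^sub>M j\<in>insert i J. K ((\<mu>(i := m)) j)))
    = (\<integral>\<^sup>+x. \<integral>\<^sup>+y. f (x(i := y)) \<partial>K m \<partial>(\<Pi>\<^sub>M j\<in>J. K (\<mu> j)))"
proof -
  let ?\<nu> = "\<mu>(i := m)"
  have \<nu>: "?\<nu> \<in> space (\<Pi>\<^sub>M j\<in>insert i J. M)"
    using \<mu> m by (auto simp: space_PiM PiE_iff extensional_def)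
  have "subprob_space (K (?\<nu> j))" if "j \<in> insert i J" for j
    using \<nu> that by (intro subprob_space_kernel[OF kernel]) (auto simp: space_PiM PiE_iff)
  then have "sigma_finite_measure (K (?\<nu> j))" if "j \<in> insert i J" for j
    using that by (simp add: finite_measure.axioms(1) subprob_space.axioms(1))
  moreover have "f \<in> borel_measurable (\<Pi>\<^sub>M j\<in>insert i J. K (?\<nu> j))"
    using f sets_kernel[OF measurable_product_kernel[OF _ refl] \<nu>] J by (simp cong: measurable_cong_sets)
  moreover have "(\<Pi>\<^sub>M j\<in>J. K (?\<nu> j)) = (\<Pi>\<^sub>M j\<in>J. K (\<mu> j))"
    using J by (intro PiM_cong) auto
  ultimately show ?thesis
    by (subst nn_integral_PiM_insert[OF J]) simp_all
qed

lemma component_risk_insert: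
  assumes F: "F \<in> space (prob_algebra M)" and J: "finite J" "i \<notin> J"
    and T [measurable]: "T \<in> borel_measurable (\<Pi>\<^sub>M j\<in>insert i J. N)"
  shows "component_risk (insert i J) i T (\<Pi>\<^sub>M j\<in>insert i J. F)
    = (\<integral>\<^sup>+\<mu>. \<integral>\<^sup>+x. sq_risk (\<lambda>y. T (x(i := y))) F \<partial>(\<Pi>\<^sub>M j\<in>J. K (\<mu> j)) \<partial>(\<Pi>\<^sub>M j\<in>J. F))"
proof -
  have sets_F [measurable_cong]: "sets F = sets M"
    using F by (simp add: space_prob_algebra)
  have sets_PiM_F: "sets (\<Pi>\<^sub>M j\<in>I. F) = sets (\<Pi>\<^sub>M j\<in>I. M)" for I
    by (intro sets_PiM_cong refl sets_F)
  interpret F: prob_space F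
    using F by (simp add: space_prob_algebra)
  let ?risk = "\<lambda>\<mu> m. \<integral>\<^sup>+x. ennreal ((T x - g m)\<^sup>2) \<partial>(\<Pi>\<^sub>M j\<in>insert i J. K (\<mu> j))"
  have "component_risk (insert i J) i T (\<Pi>\<^sub>M j\<in>insert i J. F)
      = (\<integral>\<^sup>+\<mu>. \<integral>\<^sup>+m. ?risk (\<mu>(i := m)) m \<partial>F \<partial>(\<Pi>\<^sub>M j\<in>J. F))"
    unfolding component_risk_def using J T F.sigma_finite_measure_axioms
    by (subst nn_integral_PiM_insert)
      (auto intro!: measurable_conditional_component_risk sets_PiM_F)
  also have "\<dots> = (\<integral>\<^sup>+\<mu>. \<integral>\<^sup>+x. sq_risk (\<lambda>y. T (x(i := y))) F \<partial>(\<Pi>\<^sub>M j\<in>J. K (\<mu> j)) \<partial>(\<Pi>\<^sub>M j\<in>J. F))"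
  proof (rule nn_integral_cong)
    fix \<mu> assume \<mu>: "\<mu> \<in> space (\<Pi>\<^sub>M j\<in>J. F)"
    let ?KJ = "\<Pi>\<^sub>M j\<in>J. K (\<mu> j)"
    interpret KJ: subprob_space ?KJ
      using subprob_space_kernel[OF measurable_product_kernel[OF J(1) sets_PiM_F] \<mu>] .
    interpret pair_sigma_finite ?KJ F ..
    have [measurable_cong]: "sets ?KJ = sets (\<Pi>\<^sub>M j\<in>J. N)"
      using sets_kernel[OF measurable_product_kernel[OF J(1) sets_PiM_F] \<mu>] .
    have "(\<integral>\<^sup>+m. ?risk (\<mu>(i := m)) m \<partial>F)
        = (\<integral>\<^sup>+m. \<integral>\<^sup>+x. \<integral>\<^sup>+y. ennreal ((T (x(i := y)) - g m)\<^sup>2) \<partial>K m \<partial>?KJ \<partial>F)"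
      using \<mu> sets_eq_imp_space_eq[OF sets_F]
      by (intro nn_integral_cong nn_integral_product_kernel_insert J) (auto simp: space_PiM)
    also have "\<dots> = (\<integral>\<^sup>+x. sq_risk (\<lambda>y. T (x(i := y))) F \<partial>?KJ)"
      unfolding sq_risk_def by (rule Fubini') measurable
    finally show "(\<integral>\<^sup>+m. ?risk (\<mu>(i := m)) m \<partial>F) = (\<integral>\<^sup>+x. sq_risk (\<lambda>y. T (x(i := y))) F \<partial>?KJ)" .
  qed
  finally show ?thesis .
qed

lemma bayes_value_le_slice_risk:
  assumes J: "finite J" "i \<notin> J" and \<mu>: "\<mu> \<in> space (\<Pi>\<^sub>M j\<in>J. M)"
    and markov: "\<And>j. j \<in> J \<Longrightarrow> prob_space (K (\<mu> j))"
    and T: "T \<in> borel_measurable (\<Pi>\<^sub>M j\<in>insert i J. N)"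
  shows "bayes_value F \<le> (\<integral>\<^sup>+x. sq_risk (\<lambda>y. T (x(i := y))) F \<partial>(\<Pi>\<^sub>M j\<in>J. K (\<mu> j)))"
proof -
  interpret KJ: prob_space "\<Pi>\<^sub>M j\<in>J. K (\<mu> j)"
    using markov by (rule prob_space_PiM)
  have "space (\<Pi>\<^sub>M j\<in>J. K (\<mu> j)) = space (\<Pi>\<^sub>M j\<in>J. N)"
    using sets_kernel[OF measurable_product_kernel[OF J(1) refl] \<mu>] by (rule sets_eq_imp_space_eq)
  then have slice: "(\<lambda>y. T (x(i := y))) \<in> borel_measurable N" if "x \<in> space (\<Pi>\<^sub>M j\<in>J. K (\<mu> j))" for x
    using that J by (intro measurable_compose[OF measurable_fun_upd[where J = J] T]) auto
  have "bayes_value F = (\<integral>\<^sup>+x. bayes_value F \<partial>(\<Pi>\<^sub>M j\<in>J. K (\<mu> j)))"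
    by (simp add: KJ.emeasure_space_1)
  also have "\<dots> \<le> (\<integral>\<^sup>+x. sq_risk (\<lambda>y. T (x(i := y))) F \<partial>(\<Pi>\<^sub>M j\<in>J. K (\<mu> j)))"
    by (intro nn_integral_mono bayes_value_le slice)
  finally show ?thesis .
qed

lemma bayes_value_le_component_risk:
  assumes F: "F \<in> space (prob_algebra M)" and markov: "AE m in F. prob_space (K m)"
    and I: "finite I" "i \<in> I" and T: "T \<in> borel_measurable (\<Pi>\<^sub>M j\<in>I. N)"
  shows "bayes_value F \<le> component_risk I i T (\<Pi>\<^sub>M j\<in>I. F)"
proof -
  define J where "J = I - {i}"
  have J: "I = insert i J" "finite J" "i \<notin> J"
    using I by (auto simp: J_def)
  have F_prob: "prob_space F" and sets_F: "sets F = sets M"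
    using F by (simp_all add: space_prob_algebra)
  interpret FJ: prob_space "\<Pi>\<^sub>M j\<in>J. F"
    by (rule prob_space_PiM) (rule F_prob)
  have space_FJ: "space (\<Pi>\<^sub>M j\<in>J. F) = space (\<Pi>\<^sub>M j\<in>J. M)"
    using sets_eq_imp_space_eq[OF sets_F] by (simp add: space_PiM)
  have "AE \<mu> in (\<Pi>\<^sub>M j\<in>J. F). \<forall>j\<in>J. prob_space (K (\<mu> j))"
    using J by (intro AE_ball_countable[THEN iffD2] ballI AE_PiM_component F_prob markov)
      (auto intro: countable_finite)
  then have "AE \<mu> in (\<Pi>\<^sub>M j\<in>J. F).
      bayes_value F \<le> (\<integral>\<^sup>+x. sq_risk (\<lambda>y. T (x(i := y))) F \<partial>(\<Pi>\<^sub>M j\<in>J. K (\<mu> j)))"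
    using AE_space
    by eventually_elim (use J T space_FJ in \<open>auto intro!: bayes_value_le_slice_risk\<close>)
  then have "(\<integral>\<^sup>+\<mu>. bayes_value F \<partial>(\<Pi>\<^sub>M j\<in>J. F))
    \<le> (\<integral>\<^sup>+\<mu>. \<integral>\<^sup>+x. sq_risk (\<lambda>y. T (x(i := y))) F \<partial>(\<Pi>\<^sub>M j\<in>J. K (\<mu> j)) \<partial>(\<Pi>\<^sub>M j\<in>J. F))"
    by (rule nn_integral_mono_AE)
  then show ?thesis
    using component_risk_insert[OF F J(2,3)] T unfolding J(1) by (simp add: FJ.emeasure_space_1)
qed

end

subsection \<open>The minimax theorem for minorized experiments\<close>

lemma ennreal_convex_combination_bound:
  fixes a b V :: ennreal
  assumes l: "0 < l" "l < 1" and nonneg: "0 \<le> \<epsilon>" "0 \<le> e" and V: "V < \<top>"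
    and combination: "ennreal l * a + ennreal (1 - l) * b \<le> V + ennreal \<epsilon>"
    and lower: "V \<le> b + ennreal e"
  shows "a \<le> V + ennreal ((\<epsilon> + (1 - l) * e) / l)"
proof -
  from V obtain v where v: "V = ennreal v" "0 \<le> v"
    by (cases V) auto
  have "ennreal l * a + ennreal (1 - l) * b < \<top>"
    using combination by (rule order.strict_trans1) (use V in simp)
  then have "a < \<top>" "b < \<top>"
    using l by (auto simp: ennreal_mult_less_top)
  then obtain \<alpha> \<beta> where \<alpha>: "a = ennreal \<alpha>" "0 \<le> \<alpha>" and \<beta>: "b = ennreal \<beta>" "0 \<le> \<beta>"
    by (metis ennreal_cases less_irrefl)
  have "ennreal v \<le> ennreal (\<beta> + e)"
    using lower v \<beta> nonneg by simp
  then have "(1 - l) * v \<le> (1 - l) * (\<beta> + e)"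
    using l \<beta> nonneg by (intro mult_left_mono) (simp_all del: ennreal_plus)
  moreover have "ennreal (l * \<alpha> + (1 - l) * \<beta>) \<le> ennreal (v + \<epsilon>)"
    using combination v \<alpha> \<beta> l nonneg by (simp add: ennreal_mult)
  then have "l * \<alpha> + (1 - l) * \<beta> \<le> v + \<epsilon>"
    using v nonneg by (simp del: ennreal_plus)
  ultimately have "\<alpha> \<le> v + (\<epsilon> + (1 - l) * e) / l"
    using l by (simp add: field_simps)
  then show ?thesis
    using v \<alpha> nonneg l by (simp add: ennreal_leI flip: ennreal_plus)
qed

text \<open>\<open>N\<close> doubles as the reference measure here; in \<open>bayes_estimation\<close> only its \<open>\<sigma>\<close>-algebra matters.\<close>

locale minorized_bayes_estimation = bayes_estimation M N K g
  for M :: "'m measure" and N :: "'x measure" and K g +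
  fixes P :: "'m measure set"
  assumes priors: "P \<subseteq> space (prob_algebra M)"
    and mixture: "\<lbrakk>F \<in> P; G \<in> P; 0 \<le> l; l \<le> 1\<rbrakk> \<Longrightarrow> bernoulli_mixture l F G \<in> P"
    and absolutely_continuous_kernel: "m \<in> space M \<Longrightarrow> absolutely_continuous N (K m)"
    and minorized: "\<exists>c>0. \<forall>F\<in>P. scale_measure (ennreal c) N \<le> F \<bind> K"
begin

definition maximin :: ennreal where
  "maximin = (SUP F\<in>P. bayes_value F)"

definition near_saddle_rule :: "real \<Rightarrow> ('x \<Rightarrow> real) \<Rightarrow> bool" where
  "near_saddle_rule \<delta> s \<longleftrightarrow> s \<in> borel_measurable N
    \<and> (\<exists>F\<in>P. maximin \<le> bayes_value F + ennreal \<delta> \<and> sq_risk s F \<le> maximin + ennreal \<delta>)"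

lemma near_saddle_rule_measurable: "near_saddle_rule \<delta> s \<Longrightarrow> s \<in> borel_measurable N"
  by (simp add: near_saddle_rule_def)

lemma near_saddle_rule_mono:
  assumes "near_saddle_rule \<delta> s" "\<delta> \<le> \<delta>'"
  shows "near_saddle_rule \<delta>' s"
  using assms unfolding near_saddle_rule_def by (meson add_left_mono ennreal_leI order_trans)

lemma sets_prior: "F \<in> P \<Longrightarrow> sets F = sets M"
  using priors by (auto simp: space_prob_algebra)

lemma sets_bind_prior:
  assumes "F \<in> P"
  shows "sets (F \<bind> K) = sets N"
proof -
  have "F \<in> space (prob_algebra M)"
    using assms priors by auto
  then show ?thesis
    using measurable_kernel_prior[OF sets_prior[OF assms]]
    by (intro sets_bind_measurable) (auto simp: space_prob_algebra prob_space.not_empty)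
qed

lemma near_optimal_rule_for_mixture:
  assumes FG: "F \<in> P" "G \<in> P" and l: "0 \<le> l" "l \<le> 1" and fin: "maximin < \<top>" and \<epsilon>: "0 < \<epsilon>"
  obtains s where "s \<in> borel_measurable N"
    "ennreal l * sq_risk s F + ennreal (1 - l) * sq_risk s G \<le> maximin + ennreal \<epsilon>"
proof -
  let ?H = "bernoulli_mixture l F G"
  have "bayes_value ?H \<le> maximin"
    unfolding maximin_def by (rule SUP_upper) (rule mixture[OF FG l])
  also have "maximin < maximin + ennreal \<epsilon>"
    using fin \<epsilon> ennreal_add_left_cancel_less[of maximin 0 "ennreal \<epsilon>"] by auto
  finally obtain s where s: "s \<in> borel_measurable N" "sq_risk s ?H < maximin + ennreal \<epsilon>"
    unfolding bayes_value_def by (auto simp: INF_less_iff)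
  have "F \<in> space (prob_algebra M)" "G \<in> space (prob_algebra M)"
    using FG priors by auto
  then show thesis
    using s l by (intro that[OF s(1)]) (simp add: sq_risk_bernoulli_mixture)
qed

lemma sq_dist_half_mixture_rule:
  assumes FG: "F \<in> P" "G \<in> P" and su: "s \<in> borel_measurable N" "u \<in> borel_measurable N"
    and fin: "maximin < \<top>" and \<delta>: "0 < \<delta>"
    and lower: "maximin \<le> bayes_value F + ennreal \<delta>" "maximin \<le> bayes_value G + ennreal \<delta>"
    and s: "sq_risk s F \<le> maximin + ennreal \<delta>"
    and u: "ennreal (1 / 2) * sq_risk u F + ennreal (1 / 2) * sq_risk u G \<le> maximin + ennreal \<delta>"
  shows "sq_dist (F \<bind> K) s u \<le> ennreal (14 * \<delta>)"
proof -
  have "maximin \<le> sq_risk u G + ennreal \<delta>"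
    using lower(2) bayes_value_le[OF su(2)] by (meson add_right_mono order_trans)
  then have "sq_risk u F \<le> maximin + ennreal ((\<delta> + (1 - 1 / 2) * \<delta>) / (1 / 2))"
    using u fin \<delta> by (intro ennreal_convex_combination_bound) auto
  then have "sq_dist (F \<bind> K) s u \<le> ennreal (2 * \<delta> + 2 * ((\<delta> + (1 - 1 / 2) * \<delta>) / (1 / 2)) + 4 * \<delta>)"
    using FG lower s fin \<delta> sets_prior by (intro near_bayes_rules_close su) auto
  also have "\<dots> \<le> ennreal (14 * \<delta>)"
    using \<delta> by (intro ennreal_leI) simp
  finally show ?thesis .
qed

text \<open>A near-optimal rule for the even mixture of the two priors is near-optimal for either of them.\<close>

lemma near_saddle_rules_common_neighbour:
  assumes fin: "maximin < \<top>" and \<delta>: "0 < \<delta>"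
    and near: "near_saddle_rule \<delta> s" "near_saddle_rule \<delta> t"
  obtains u F G where "u \<in> borel_measurable N" "F \<in> P" "G \<in> P"
    "sq_dist (F \<bind> K) s u \<le> ennreal (14 * \<delta>)" "sq_dist (G \<bind> K) t u \<le> ennreal (14 * \<delta>)"
proof -
  obtain F G where FG: "F \<in> P" "G \<in> P"
    and F: "maximin \<le> bayes_value F + ennreal \<delta>" "sq_risk s F \<le> maximin + ennreal \<delta>"
    and G: "maximin \<le> bayes_value G + ennreal \<delta>" "sq_risk t G \<le> maximin + ennreal \<delta>"
    using near unfolding near_saddle_rule_def by auto
  obtain u where u: "u \<in> borel_measurable N"
    and half: "ennreal (1 / 2) * sq_risk u F + ennreal (1 / 2) * sq_risk u G \<le> maximin + ennreal \<delta>"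
    using near_optimal_rule_for_mixture[OF FG, of "1 / 2" \<delta>] fin \<delta> by auto
  note st = near_saddle_rule_measurable[OF near(1)] near_saddle_rule_measurable[OF near(2)]
  have "sq_dist (F \<bind> K) s u \<le> ennreal (14 * \<delta>)"
    using sq_dist_half_mixture_rule[OF FG st(1) u fin \<delta> F(1) G(1) F(2) half] .
  moreover have "sq_dist (G \<bind> K) t u \<le> ennreal (14 * \<delta>)"
    using sq_dist_half_mixture_rule[OF FG(2,1) st(2) u fin \<delta> G(1) F(1) G(2)] half
    by (simp add: add.commute)
  ultimately show thesis
    by (rule that[OF u FG])
qed

lemma near_saddle_rules_close:
  assumes fin: "maximin < \<top>"
  shows "\<exists>C\<ge>0. \<forall>\<delta>>0. \<forall>s t. near_saddle_rule \<delta> s \<longrightarrow> near_saddle_rule \<delta> t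
    \<longrightarrow> sq_dist N s t \<le> ennreal (C * \<delta>)"
proof -
  obtain c where c: "0 < c" and minorized_by_c: "\<And>F. F \<in> P \<Longrightarrow> scale_measure (ennreal c) N \<le> F \<bind> K"
    using minorized by auto
  have "sq_dist N s t \<le> ennreal (56 / c * \<delta>)"
    if \<delta>: "0 < \<delta>" and near: "near_saddle_rule \<delta> s" "near_saddle_rule \<delta> t" for \<delta> s t
  proof -
    note st = near_saddle_rule_measurable[OF near(1)] near_saddle_rule_measurable[OF near(2)]
    obtain u F G where u: "u \<in> borel_measurable N" and FG: "F \<in> P" "G \<in> P"
      and close: "sq_dist (F \<bind> K) s u \<le> ennreal (14 * \<delta>)" "sq_dist (G \<bind> K) t u \<le> ennreal (14 * \<delta>)"
      using near_saddle_rules_common_neighbour[OF fin \<delta> near] .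
    have "ennreal c * sq_dist N s t \<le> ennreal c * (2 * sq_dist N s u + 2 * sq_dist N t u)"
      using sq_dist_triangle[OF st u] by (rule mult_left_mono) simp
    also have "\<dots> = 2 * (ennreal c * sq_dist N s u) + 2 * (ennreal c * sq_dist N t u)"
      by (simp add: distrib_left mult.left_commute)
    also have "\<dots> \<le> 2 * sq_dist (F \<bind> K) s u + 2 * sq_dist (G \<bind> K) t u"
      using FG st u
      by (intro add_mono mult_left_mono scale_sq_dist_le sets_bind_prior minorized_by_c) auto
    also have "\<dots> \<le> 2 * ennreal (14 * \<delta>) + 2 * ennreal (14 * \<delta>)"
      using close by (intro add_mono mult_left_mono) auto
    also have "\<dots> = ennreal (56 * \<delta>)"
      using \<delta> by (simp add: ennreal_mult[symmetric] flip: ennreal_plus ennreal_numeral)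
    finally have "ennreal (1 / c) * (ennreal c * sq_dist N s t) \<le> ennreal (1 / c) * ennreal (56 * \<delta>)"
      by (rule mult_left_mono) simp
    then show ?thesis
      using c \<delta> by (simp add: mult.assoc[symmetric] ennreal_mult[symmetric])
  qed
  then show ?thesis
    using c by (intro exI[of _ "56 / c"]) simp
qed

lemma near_optimal_mixture_rule_risks:
  assumes fin: "maximin < \<top>" and l: "0 < l" "l \<le> 1 / 2" and s: "s \<in> borel_measurable N"
    and F: "maximin \<le> bayes_value F + ennreal (l\<^sup>2)"
    and mix: "ennreal l * sq_risk s G + ennreal (1 - l) * sq_risk s F \<le> maximin + ennreal (l\<^sup>2)"
  shows "sq_risk s G \<le> maximin + ennreal (2 * l)"
    and "sq_risk s F \<le> maximin + ennreal ((1 + 2 * enn2real maximin) * l)"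
proof -
  define v where "v = enn2real maximin"
  have v: "ennreal v = maximin" "0 \<le> v"
    using fin by (simp_all add: v_def)
  have "maximin \<le> sq_risk s F + ennreal (l\<^sup>2)"
    using F bayes_value_le[OF s] by (meson add_right_mono order_trans)
  then have "sq_risk s G \<le> maximin + ennreal ((l\<^sup>2 + (1 - l) * l\<^sup>2) / l)"
    using l fin mix by (intro ennreal_convex_combination_bound) auto
  also have "\<dots> \<le> maximin + ennreal (2 * l)"
    using l by (intro add_left_mono ennreal_leI) (simp add: power2_eq_square field_simps)
  finally show "sq_risk s G \<le> maximin + ennreal (2 * l)" .
  have "maximin \<le> sq_risk s G + ennreal v"
    by (simp add: v)
  then have "sq_risk s F \<le> maximin + ennreal ((l\<^sup>2 + (1 - (1 - l)) * v) / (1 - l))"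
    using l fin mix v
    by (intro ennreal_convex_combination_bound[where b = "sq_risk s G"]) (auto simp: add.commute)
  also have "(l\<^sup>2 + (1 - (1 - l)) * v) / (1 - l) \<le> (l\<^sup>2 + l * v) / (1 / 2)"
    using l v by (intro frac_le) auto
  also have "\<dots> \<le> (1 + 2 * v) * l"
    using mult_left_mono[OF l(2), of l] l by (simp add: power2_eq_square algebra_simps)
  finally show "sq_risk s F \<le> maximin + ennreal ((1 + 2 * enn2real maximin) * l)"
    by (simp add: v_def add_left_mono ennreal_leI)
qed

text \<open>
  The Bayes value of \<open>G\<close> may be far below the maximin value, so \<open>G\<close> enters the mixture with a small
  weight \<open>l\<close>; accuracy \<open>l\<^sup>2\<close> is then enough to control the risk at \<open>G\<close>.
\<close>

lemma near_saddle_rule_exists: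
  assumes G: "G \<in> P" and fin: "maximin < \<top>" and l: "0 < l" "l \<le> 1 / 2"
  shows "\<exists>s. near_saddle_rule ((1 + 2 * enn2real maximin) * l) s
    \<and> sq_risk s G \<le> maximin + ennreal (2 * l)"
proof -
  have "\<exists>F\<in>P. maximin < bayes_value F + ennreal (l\<^sup>2)"
    using G l fin by (intro SUP_approx_ennreal maximin_def) auto
  then obtain F where F: "F \<in> P" "maximin \<le> bayes_value F + ennreal (l\<^sup>2)"
    by (auto intro: less_imp_le)
  obtain s where s: "s \<in> borel_measurable N"
    and mix: "ennreal l * sq_risk s G + ennreal (1 - l) * sq_risk s F \<le> maximin + ennreal (l\<^sup>2)"
    using near_optimal_rule_for_mixture[OF G F(1), of l "l\<^sup>2"] l fin by auto
  have "l * l \<le> (1 + 2 * enn2real maximin) * l"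
    using l by (intro mult_right_mono) (auto intro: add_increasing2)
  then have "maximin \<le> bayes_value F + ennreal ((1 + 2 * enn2real maximin) * l)"
    using F(2) unfolding power2_eq_square by (meson add_left_mono ennreal_leI order_trans)
  with near_optimal_mixture_rule_risks[OF fin l s F(2) mix] show ?thesis
    using s F(1) unfolding near_saddle_rule_def by blast
qed

lemma near_saddle_rule_seqs_AE:
  assumes fin: "maximin < \<top>"
    and s: "\<And>k. near_saddle_rule (D * (1 / 4) ^ k) (s k)"
    and t: "\<And>k. near_saddle_rule (D * (1 / 4) ^ k) (t k)"
    and D: "0 < D"
  shows "AE x in N. convergent (\<lambda>k. t k x)" "AE x in N. (\<lambda>k. s k x - t k x) \<longlonglongrightarrow> 0"
proof -
  obtain C where C: "0 \<le> C"
    and close: "\<And>\<delta> s t. \<lbrakk>0 < \<delta>; near_saddle_rule \<delta> s; near_saddle_rule \<delta> t\<rbrakk>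
      \<Longrightarrow> sq_dist N s t \<le> ennreal (C * \<delta>)"
    using near_saddle_rules_close[OF fin] by auto
  have close_k: "sq_dist N u v \<le> ennreal (C * D * (1 / 4) ^ k)"
    if "near_saddle_rule (D * (1 / 4) ^ k) u" "near_saddle_rule (D * (1 / 4) ^ k) v" for u v k
    using close[OF _ that] D by (simp add: mult.assoc)
  have "near_saddle_rule (D * (1 / 4) ^ k) (t (Suc k))" for k
    by (rule near_saddle_rule_mono[OF t[of "Suc k"]]) (use D in simp)
  then show "AE x in N. convergent (\<lambda>k. t k x)"
    using C D t
    by (intro AE_convergent_of_sq_dist_le[where C = "C * D"] close_k near_saddle_rule_measurable[OF t]) auto
  have "AE x in N. summable (\<lambda>k. s k x - t k x)"
    using C D s t
    by (intro AE_summable_diff_of_sq_dist_le[where C = "C * D"] close_k near_saddle_rule_measurable[OF t]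
        near_saddle_rule_measurable[OF s]) auto
  then show "AE x in N. (\<lambda>k. s k x - t k x) \<longlonglongrightarrow> 0"
    by eventually_elim (rule summable_LIMSEQ_zero)
qed

lemma near_saddle_rule_seq_exists:
  assumes "G \<in> P" "maximin < \<top>"
  obtains s where "\<And>k. near_saddle_rule ((1 + 2 * enn2real maximin) * (1 / 4) ^ k) (s k)"
    "\<And>k. sq_risk (s k) G \<le> maximin + ennreal ((1 / 4) ^ k)"
proof -
  let ?D = "1 + 2 * enn2real maximin"
  have "\<exists>s. near_saddle_rule (?D * (1 / 4) ^ k) s \<and> sq_risk s G \<le> maximin + ennreal ((1 / 4) ^ k)" for k
  proof -
    have "(1 / 4) ^ k / 2 \<le> (1 / 2 :: real)"
      by (simp add: power_le_one)
    then obtain s where s: "near_saddle_rule (?D * ((1 / 4) ^ k / 2)) s"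
      "sq_risk s G \<le> maximin + ennreal (2 * ((1 / 4) ^ k / 2))"
      using near_saddle_rule_exists[OF assms, of "(1 / 4) ^ k / 2"] by auto
    have "near_saddle_rule (?D * (1 / 4) ^ k) s"
      using s(1) by (rule near_saddle_rule_mono) (auto intro!: mult_left_mono)
    then show ?thesis
      using s(2) by auto
  qed
  then show thesis
    using that by metis
qed

lemma minimax_rule_exists:
  assumes "P \<noteq> {}" and fin: "maximin < \<top>"
  shows "\<exists>\<tau>\<in>borel_measurable N. \<forall>G\<in>P. sq_risk \<tau> G \<le> maximin"
proof -
  let ?D = "1 + 2 * enn2real maximin"
  have D: "0 < ?D" by (simp add: add_pos_nonneg)
  from \<open>P \<noteq> {}\<close> obtain F where "F \<in> P" by auto
  then obtain t where t: "\<And>k. near_saddle_rule (?D * (1 / 4) ^ k) (t k)"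
    using near_saddle_rule_seq_exists fin by blast
  define \<tau> where "\<tau> x = lim (\<lambda>k. t k x)" for x
  have "\<tau> \<in> borel_measurable N"
    unfolding \<tau>_def by (rule borel_measurable_lim_metric) (rule near_saddle_rule_measurable[OF t])
  moreover have "sq_risk \<tau> G \<le> maximin" if G: "G \<in> P" for G
  proof -
    obtain s where s: "\<And>k. near_saddle_rule (?D * (1 / 4) ^ k) (s k)"
      and risk: "\<And>k. sq_risk (s k) G \<le> maximin + ennreal ((1 / 4) ^ k)"
      using near_saddle_rule_seq_exists[OF G fin] by blast
    have "AE x in N. (\<lambda>k. s k x) \<longlonglongrightarrow> \<tau> x"
      using near_saddle_rule_seqs_AE[OF fin s t D]
    proof eventually_elim
      case (elim x)
      then have "(\<lambda>k. s k x - t k x + t k x) \<longlonglongrightarrow> 0 + \<tau> x"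
        by (intro tendsto_add) (auto simp: \<tau>_def convergent_LIMSEQ_iff)
      then show ?case by simp
    qed
    then have "sq_risk \<tau> G \<le> liminf (\<lambda>k. sq_risk (s k) G)"
      using s
      by (intro sq_risk_le_liminf sets_prior G near_saddle_rule_measurable absolutely_continuous_kernel)
    also have "\<dots> \<le> liminf (\<lambda>k. maximin + ennreal ((1 / 4) ^ k))"
      by (intro Liminf_mono always_eventually allI risk)
    also have "\<dots> = maximin + ennreal 0"
      by (intro lim_imp_Liminf sequentially_bot tendsto_add tendsto_const tendsto_ennrealI
          LIMSEQ_power_zero) simp
    finally show ?thesis by simp
  qed
  ultimately show ?thesis by auto
qed

theorem minimax_sq_risk:
  "(INF t\<in>borel_measurable N. SUP F\<in>P. sq_risk t F) = (SUP F\<in>P. bayes_value F)"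
proof (rule antisym)
  show "(SUP F\<in>P. bayes_value F) \<le> (INF t\<in>borel_measurable N. SUP F\<in>P. sq_risk t F)"
    by (intro INF_greatest SUP_subset_mono order_refl bayes_value_le)
  show "(INF t\<in>borel_measurable N. SUP F\<in>P. sq_risk t F) \<le> (SUP F\<in>P. bayes_value F)"
  proof -
    consider "P = {}" | "maximin = \<top>" | "P \<noteq> {}" "maximin < \<top>"
      by (metis top.not_eq_extremum)
    then show ?thesis
    proof cases
      case 1
      then show ?thesis by (auto intro!: INF_lower2[of "\<lambda>_. 0"])
    next
      case 2
      then show ?thesis by (simp flip: maximin_def)
    next
      case 3
      then obtain \<tau> where "\<tau> \<in> borel_measurable N" "\<And>G. G \<in> P \<Longrightarrow> sq_risk \<tau> G \<le> maximin"
        using minimax_rule_exists by auto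
      then show ?thesis
        unfolding maximin_def by (intro INF_lower2[of \<tau>] SUP_least)
    qed
  qed
qed

end

subsection \<open>Exponential data\<close>

lemma sets_exp_law [simp, measurable_cong]: "sets (exp_law m) = sets borel"
  by (simp add: exp_law_def)

lemma measurable_exponential_density [measurable]:
  "(\<lambda>(m, x). exponential_density (1 / m) x) \<in> borel_measurable (borel \<Otimes>\<^sub>M borel)"
  unfolding exponential_density_def by measurable

lemma prob_space_exp_law: "0 < m \<Longrightarrow> prob_space (exp_law m)"
  unfolding exp_law_def by (rule prob_space_exponential_density) simp

lemma exp_law_nonpos_mean:
  assumes "m \<le> 0"
  shows "exp_law m = null_measure lborel"
proof -
  have "exponential_density (1 / m) x \<le> 0" for x
    using assms by (simp add: exponential_density_def divide_nonneg_nonpos)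
  then show ?thesis
    by (intro measure_eqI) (simp_all add: exp_law_def emeasure_density ennreal_neg)
qed

lemma exp_law_eq_density:
  "exp_law m = density (exp_law 1) (\<lambda>x. ennreal (1 / m * exp (x - x / m)))"
proof -
  have "ennreal (exponential_density 1 x) * ennreal (1 / m * exp (x - x / m))
      = ennreal (exponential_density (1 / m) x)" for x
    by (simp add: exponential_density_def ennreal_mult'[symmetric] exp_diff exp_minus field_simps)
  then show ?thesis
    unfolding exp_law_def by (subst density_density_eq) simp_all
qed

lemma absolutely_continuous_exp_law: "absolutely_continuous (exp_law 1) (exp_law m)"
  by (subst exp_law_eq_density) (rule absolutely_continuousI_density, measurable)

lemma emeasure_exp_law_ge:
  assumes m: "1 \<le> m" and [measurable]: "A \<in> sets borel"
  shows "ennreal (1 / m) * emeasure (exp_law 1) A \<le> emeasure (exp_law m) A"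
proof -
  have "AE x in exp_law 1. 0 \<le> x"
    unfolding exp_law_def by (subst AE_density) (auto simp: exponential_density_def)
  then have density_ge: "AE x in exp_law 1. ennreal (1 / m) \<le> ennreal (1 / m * exp (x - x / m))"
  proof eventually_elim
    case (elim x)
    have "x / m \<le> x"
      using elim m by (simp add: divide_le_eq mult_le_cancel_left1)
    then have "1 / m * 1 \<le> 1 / m * exp (x - x / m)"
      using m by (intro mult_left_mono) auto
    then show ?case
      by (intro ennreal_leI) simp
  qed
  have "ennreal (1 / m) * emeasure (exp_law 1) A = (\<integral>\<^sup>+x. ennreal (1 / m) * indicator A x \<partial>exp_law 1)"
    by (rule nn_integral_cmult_indicator[symmetric]) simp
  also have "\<dots> \<le> (\<integral>\<^sup>+x. ennreal (1 / m * exp (x - x / m)) * indicator A x \<partial>exp_law 1)"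
    using density_ge by (intro nn_integral_mono_AE) (auto elim!: eventually_mono intro!: mult_right_mono)
  also have "\<dots> = emeasure (exp_law m) A"
    by (subst (2) exp_law_eq_density, rule emeasure_density[symmetric]) simp_all
  finally show ?thesis .
qed

lemma exp_law_kernel: "exp_law \<in> borel \<rightarrow>\<^sub>M subprob_algebra borel"
proof (rule measurable_subprob_algebra)
  show "subprob_space (exp_law m)" for m
  proof (cases "0 < m")
    case True
    then show ?thesis
      by (intro prob_space_imp_subprob_space prob_space_exp_law)
  next
    case False
    then show ?thesis
      by (intro subprob_spaceI) (simp_all add: exp_law_nonpos_mean)
  qed
  show "(\<lambda>m. emeasure (exp_law m) A) \<in> borel_measurable borel" if [measurable]: "A \<in> sets borel" for A
    unfolding exp_law_def by (subst emeasure_density) simp_all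
qed simp

interpretation exp_mean: bayes_estimation borel "exp_law 1" exp_law ln
  by unfold_locales (simp_all add: exp_law_kernel cong: measurable_cong_sets subprob_algebra_cong)

lemma bayes_risk1_eq_sq_risk: "bayes_risk1 \<delta> F = exp_mean.sq_risk (\<lambda>x. ln (\<delta> x)) F"
  by (simp add: bayes_risk1_def exp_mean.sq_risk_def)

lemma rho_bar_eq_INF_sq_risk:
  "rho_bar p \<eta> = (INF t\<in>borel_measurable (exp_law 1). SUP F\<in>prior_class1 p \<eta>. exp_mean.sq_risk t F)"
proof -
  have log_rules: "(\<lambda>\<delta> x. ln (\<delta> x)) ` estimators1 = borel_measurable (exp_law 1)"
  proof (intro set_eqI iffI)
    fix t :: "real \<Rightarrow> real" assume "t \<in> borel_measurable (exp_law 1)"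
    then have "(\<lambda>x. exp (t x)) \<in> estimators1"
      by (simp add: estimators1_def)
    then show "t \<in> (\<lambda>\<delta> x. ln (\<delta> x)) ` estimators1"
      by (auto intro!: image_eqI)
  qed (auto simp: estimators1_def)
  show ?thesis
    unfolding rho_bar_def bayes_risk1_eq_sq_risk log_rules[symmetric] by (simp add: image_image)
qed

lemma prior_class1_iff:
  "F \<in> prior_class1 p \<eta> \<longleftrightarrow> F \<in> space (prob_algebra borel) \<and> (AE m in F. 1 \<le> m)
    \<and> (\<integral>\<^sup>+m. ennreal (ln m powr p) \<partial>F) \<le> ennreal (\<eta> powr p)"
  by (auto simp: prior_class1_def space_prob_algebra)

lemma bernoulli_mixture_in_prior_class1:
  assumes FG: "F \<in> prior_class1 p \<eta>" "G \<in> prior_class1 p \<eta>"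
  shows "bernoulli_mixture l F G \<in> prior_class1 p \<eta>"
proof -
  have FG_prob: "(if b then F else G) \<in> space (prob_algebra borel)" for b
    using FG by (simp add: prior_class1_iff)
  have "(\<integral>\<^sup>+b. \<integral>\<^sup>+m. ennreal (ln m powr p) \<partial>(if b then F else G) \<partial>measure_pmf (bernoulli_pmf l))
      \<le> (\<integral>\<^sup>+b. ennreal (\<eta> powr p) \<partial>measure_pmf (bernoulli_pmf l))"
    using FG by (intro nn_integral_mono) (simp add: prior_class1_iff)
  moreover have "AE b in measure_pmf (bernoulli_pmf l). AE m in (if b then F else G). 1 \<le> m"
    using FG by (auto simp: AE_measure_pmf_iff prior_class1_iff)
  ultimately show ?thesis
    unfolding bernoulli_mixture_def
    by (simp add: prior_class1_iff measure_pmf_bind_in_prob_algebra[OF FG_prob]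
        AE_measure_pmf_bind_iff[OF FG_prob] nn_integral_measure_pmf_bind[OF FG_prob])
qed

lemma exp_neg_le_reciprocal_plus_moment:
  fixes m R p :: real
  assumes "1 \<le> m" "0 < p" "0 < R"
  shows "exp (- R) \<le> 1 / m + exp (- R) / R powr p * ln m powr p"
proof (cases "ln m \<le> R")
  case True
  then have "exp (- R) \<le> exp (- ln m)"
    by simp
  also have "exp (- ln m) = 1 / m"
    using assms by (simp add: exp_minus inverse_eq_divide)
  finally show ?thesis
    by (rule order_trans) simp
next
  case False
  then have "R powr p \<le> ln m powr p"
    using assms by (intro powr_mono2) auto
  then have "exp (- R) / R powr p * R powr p \<le> exp (- R) / R powr p * ln m powr p"
    by (intro mult_left_mono) auto
  then have "exp (- R) \<le> exp (- R) / R powr p * ln m powr p"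
    using assms by simp
  also have "\<dots> \<le> 1 / m + exp (- R) / R powr p * ln m powr p"
    using assms by simp
  finally show ?thesis .
qed

lemma prior_reciprocal_moment_ge:
  assumes "0 < p" "0 < \<eta>" and F: "F \<in> prior_class1 p \<eta>"
  defines "R \<equiv> \<eta> * 2 powr (1 / p)"
  shows "ennreal (exp (- R) / 2) \<le> (\<integral>\<^sup>+m. ennreal (1 / m) \<partial>F)"
proof -
  have R: "0 < R" "R powr p = 2 * \<eta> powr p"
    using assms by (simp_all add: R_def powr_mult powr_powr)
  have [measurable_cong]: "sets F = sets borel" and ge_1: "AE m in F. 1 \<le> m"
    and moment: "(\<integral>\<^sup>+m. ennreal (ln m powr p) \<partial>F) \<le> ennreal (\<eta> powr p)"
    using F by (simp_all add: prior_class1_def)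
  interpret F: prob_space F
    using F by (simp add: prior_class1_def)
  let ?c = "exp (- R) / R powr p"
  have "ennreal (exp (- R)) = (\<integral>\<^sup>+m. ennreal (exp (- R)) \<partial>F)"
    by (simp add: F.emeasure_space_1)
  also have "\<dots> \<le> (\<integral>\<^sup>+m. ennreal (1 / m) + ennreal ?c * ennreal (ln m powr p) \<partial>F)"
  proof (rule nn_integral_mono_AE, use ge_1 in eventually_elim)
    case (elim m)
    then show ?case
      using exp_neg_le_reciprocal_plus_moment[OF elim \<open>0 < p\<close> R(1)]
      by (simp add: ennreal_mult[symmetric] ennreal_plus[symmetric] ennreal_leI del: ennreal_plus)
  qed
  also have "\<dots> = (\<integral>\<^sup>+m. ennreal (1 / m) \<partial>F) + ennreal ?c * (\<integral>\<^sup>+m. ennreal (ln m powr p) \<partial>F)"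
    by (simp add: nn_integral_add nn_integral_cmult)
  also have "\<dots> \<le> (\<integral>\<^sup>+m. ennreal (1 / m) \<partial>F) + ennreal ?c * ennreal (\<eta> powr p)"
    using moment by (intro add_left_mono mult_left_mono) auto
  also have "ennreal ?c * ennreal (\<eta> powr p) = ennreal (exp (- R) / 2)"
    using assms(1,2) by (simp add: R(2) ennreal_mult[symmetric])
  finally have "ennreal (exp (- R)) - ennreal (exp (- R) / 2) \<le> (\<integral>\<^sup>+m. ennreal (1 / m) \<partial>F)"
    by (simp add: ennreal_minus_le_iff add.commute)
  then show ?thesis
    by (simp add: ennreal_minus)
qed

lemma exp_law_minorized:
  assumes "0 < p" "0 < \<eta>"
  shows "\<exists>c>0. \<forall>F\<in>prior_class1 p \<eta>. scale_measure (ennreal c) (exp_law 1) \<le> F \<bind> exp_law"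
proof (intro exI conjI ballI)
  let ?c = "exp (- (\<eta> * 2 powr (1 / p))) / 2"
  show "0 < ?c" by simp
  fix F assume F: "F \<in> prior_class1 p \<eta>"
  have F_prob: "prob_space F" and sets_F [measurable_cong]: "sets F = sets borel"
    and ge_1: "AE m in F. 1 \<le> m"
    using F by (simp_all add: prior_class1_def)
  have nonempty: "space F \<noteq> {}"
    using F_prob by (rule prob_space.not_empty)
  have kernel: "exp_law \<in> F \<rightarrow>\<^sub>M subprob_algebra borel"
    using exp_law_kernel sets_F by (simp cong: measurable_cong_sets)
  have sets_bind: "sets (F \<bind> exp_law) = sets borel"
    using kernel nonempty by (rule sets_bind_measurable)
  show "scale_measure (ennreal ?c) (exp_law 1) \<le> F \<bind> exp_law"
  proof (subst le_measure)
    show "\<forall>A\<in>sets (scale_measure (ennreal ?c) (exp_law 1)).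
      emeasure (scale_measure (ennreal ?c) (exp_law 1)) A \<le> emeasure (F \<bind> exp_law) A"
    proof
      fix A assume "A \<in> sets (scale_measure (ennreal ?c) (exp_law 1))"
      then have A: "A \<in> sets borel" by simp
      have "ennreal ?c * emeasure (exp_law 1) A \<le> (\<integral>\<^sup>+m. ennreal (1 / m) \<partial>F) * emeasure (exp_law 1) A"
        using prior_reciprocal_moment_ge[OF assms F] by (rule mult_right_mono) simp
      also have "\<dots> = (\<integral>\<^sup>+m. ennreal (1 / m) * emeasure (exp_law 1) A \<partial>F)"
        by (rule nn_integral_multc[symmetric]) measurable
      also have "\<dots> \<le> (\<integral>\<^sup>+m. emeasure (exp_law m) A \<partial>F)"
        using ge_1
        by (intro nn_integral_mono_AE) (auto elim!: eventually_mono intro: emeasure_exp_law_ge[OF _ A])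
      also have "\<dots> = emeasure (F \<bind> exp_law) A"
        by (rule emeasure_bind[OF nonempty kernel A, symmetric])
      finally show "emeasure (scale_measure (ennreal ?c) (exp_law 1)) A \<le> emeasure (F \<bind> exp_law) A"
        by simp
    qed
  qed (simp add: sets_bind)
qed

lemma minorized_bayes_estimation_exp_mean:
  assumes "0 < p" "0 < \<eta>"
  shows "minorized_bayes_estimation borel (exp_law 1) exp_law ln (prior_class1 p \<eta>)"
proof unfold_locales
  show "prior_class1 p \<eta> \<subseteq> space (prob_algebra borel)"
    by (auto simp: prior_class1_iff)
qed (use exp_law_minorized[OF assms] in
    \<open>simp_all add: bernoulli_mixture_in_prior_class1 absolutely_continuous_exp_law\<close>)

lemma rho_bar_eq_SUP_bayes_value:
  assumes "0 < p" "0 < \<eta>"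
  shows "rho_bar p \<eta> = (SUP F\<in>prior_class1 p \<eta>. exp_mean.bayes_value F)"
  unfolding rho_bar_eq_INF_sq_risk
  by (rule minorized_bayes_estimation.minimax_sq_risk[OF minorized_bayes_estimation_exp_mean[OF assms]])

subsection \<open>The multivariate problem\<close>

lemma exp_data_eq_PiM: "exp_data n \<mu> = (\<Pi>\<^sub>M i\<in>{..<n}. exp_law (\<mu> i))"
  by (simp add: exp_data_def exp_law_def)

lemma measurable_ln_estimator:
  assumes "\<delta> \<in> estimators n" "i < n" and N: "\<And>j. sets (N j) = sets borel"
  shows "(\<lambda>x. ln (\<delta> x i)) \<in> borel_measurable (Pi\<^sub>M {..<n} N)"
proof -
  have "sets (Pi\<^sub>M {..<n} N) = sets (\<Pi>\<^sub>M i\<in>{..<n}. borel)"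
    by (intro sets_PiM_cong refl N)
  then show ?thesis
    using assms(1,2) by (intro borel_measurable_ln) (simp add: estimators_def cong: measurable_cong_sets)
qed

lemma bayes_risk_eq_average_component_risk:
  assumes \<pi>: "sets \<pi> = sets (\<Pi>\<^sub>M i\<in>{..<n}. borel)" and \<delta>: "\<delta> \<in> estimators n"
  shows "bayes_risk n \<delta> \<pi>
    = ennreal (1 / real n) * (\<Sum>i<n. exp_mean.component_risk {..<n} i (\<lambda>x. ln (\<delta> x i)) \<pi>)"
proof -
  let ?r = "\<lambda>i \<mu>. \<integral>\<^sup>+x. ennreal ((ln (\<delta> x i) - ln (\<mu> i))\<^sup>2) \<partial>(\<Pi>\<^sub>M j\<in>{..<n}. exp_law (\<mu> j))"
  have conditional: "?r i \<in> borel_measurable \<pi>" if "i \<in> {..<n}" for i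
    using that \<pi> \<delta>
    by (intro exp_mean.measurable_conditional_component_risk measurable_ln_estimator) auto
  have "bayes_risk n \<delta> \<pi> = (\<integral>\<^sup>+\<mu>. ennreal (1 / real n) * (\<Sum>i<n. ?r i \<mu>) \<partial>\<pi>)"
    unfolding bayes_risk_def exp_data_eq_PiM
    by (intro nn_integral_cong nn_integral_scaled_sum borel_measurable_power borel_measurable_diff
        measurable_ln_estimator[OF \<delta>]) auto
  also have "\<dots> = ennreal (1 / real n) * (\<integral>\<^sup>+\<mu>. (\<Sum>i<n. ?r i \<mu>) \<partial>\<pi>)"
    by (intro nn_integral_cmult borel_measurable_sum conditional)
  finally show ?thesis
    by (simp only: nn_integral_sum[OF conditional] exp_mean.component_risk_def)
qed

lemma coordinatewise_in_estimators:
  assumes "\<delta> \<in> estimators1"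
  shows "(\<lambda>x i. \<delta> (x i)) \<in> estimators n"
proof -
  have [measurable]: "\<delta> \<in> borel_measurable borel" and "\<And>x. 0 < \<delta> x"
    using assms by (simp_all add: estimators1_def)
  then show ?thesis
    by (simp add: estimators_def)
qed

definition average_marginal :: "nat \<Rightarrow> (nat \<Rightarrow> real) measure \<Rightarrow> real measure" where
  "average_marginal n \<pi> = measure_pmf (pmf_of_set {..<n}) \<bind> (\<lambda>i. distr \<pi> borel (\<lambda>\<mu>. \<mu> i))"

lemma coordinate_marginal_in_prob_algebra:
  assumes \<pi>: "\<pi> \<in> space (prob_algebra (\<Pi>\<^sub>M i\<in>I. borel))"
  shows "distr \<pi> borel (\<lambda>\<mu>. \<mu> i) \<in> space (prob_algebra borel)"
proof -
  have "(\<lambda>\<mu>. \<mu> i) \<in> \<pi> \<rightarrow>\<^sub>M borel"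
    using \<pi> measurable_PiM_coordinate by (simp add: space_prob_algebra cong: measurable_cong_sets)
  then show ?thesis
    using \<pi> by (simp add: space_prob_algebra prob_space.prob_space_distr)
qed

lemma nn_integral_average_marginal:
  assumes \<pi>: "\<pi> \<in> space (prob_algebra (\<Pi>\<^sub>M i\<in>{..<n}. borel))" and n: "1 \<le> n"
    and [measurable]: "f \<in> borel_measurable borel"
  shows "(\<integral>\<^sup>+m. f m \<partial>average_marginal n \<pi>) = ennreal (1 / real n) * (\<Sum>i<n. \<integral>\<^sup>+\<mu>. f (\<mu> i) \<partial>\<pi>)"
proof -
  have [measurable_cong]: "sets \<pi> = sets (\<Pi>\<^sub>M i\<in>{..<n}. borel)"
    using \<pi> by (simp add: space_prob_algebra)
  have "(\<integral>\<^sup>+m. f m \<partial>average_marginal n \<pi>)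
      = (\<integral>\<^sup>+i. \<integral>\<^sup>+m. f m \<partial>distr \<pi> borel (\<lambda>\<mu>. \<mu> i) \<partial>measure_pmf (pmf_of_set {..<n}))"
    unfolding average_marginal_def
    by (rule nn_integral_measure_pmf_bind[where N = borel])
      (simp_all add: coordinate_marginal_in_prob_algebra[OF \<pi>])
  also have "\<dots> = (\<Sum>i<n. \<integral>\<^sup>+m. f m \<partial>distr \<pi> borel (\<lambda>\<mu>. \<mu> i)) / ennreal (real n)"
    using n by (simp add: nn_integral_pmf_of_set ennreal_of_nat_eq_real_of_nat lessThan_empty_iff)
  also have "(\<Sum>i<n. \<integral>\<^sup>+m. f m \<partial>distr \<pi> borel (\<lambda>\<mu>. \<mu> i)) = (\<Sum>i<n. \<integral>\<^sup>+\<mu>. f (\<mu> i) \<partial>\<pi>)"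
    by (intro sum.cong) (auto simp: nn_integral_distr)
  finally show ?thesis
    using n by (simp add: divide_ennreal_def inverse_ennreal inverse_eq_divide mult.commute)
qed

lemma prior_class_iff:
  "\<pi> \<in> prior_class n p \<eta> \<longleftrightarrow> \<pi> \<in> space (prob_algebra (\<Pi>\<^sub>M i\<in>{..<n}. borel))
    \<and> (AE \<mu> in \<pi>. \<forall>i<n. 1 \<le> \<mu> i)
    \<and> (\<integral>\<^sup>+\<mu>. ennreal (1 / real n * (\<Sum>i<n. ln (\<mu> i) powr p)) \<partial>\<pi>) \<le> ennreal (\<eta> powr p)"
  by (auto simp: prior_class_def space_prob_algebra)

lemma average_marginal_in_prior_class1:
  assumes \<pi>: "\<pi> \<in> prior_class n p \<eta>" and n: "1 \<le> n"
  shows "average_marginal n \<pi> \<in> prior_class1 p \<eta>"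
proof -
  have \<pi>_prob: "\<pi> \<in> space (prob_algebra (\<Pi>\<^sub>M i\<in>{..<n}. borel))"
    and ge_1: "AE \<mu> in \<pi>. \<forall>i<n. 1 \<le> \<mu> i"
    and moment: "(\<integral>\<^sup>+\<mu>. ennreal (1 / real n * (\<Sum>i<n. ln (\<mu> i) powr p)) \<partial>\<pi>) \<le> ennreal (\<eta> powr p)"
    using \<pi> by (simp_all add: prior_class_iff)
  have [measurable_cong]: "sets \<pi> = sets (\<Pi>\<^sub>M i\<in>{..<n}. borel)"
    using \<pi>_prob by (simp add: space_prob_algebra)
  have "AE m in distr \<pi> borel (\<lambda>\<mu>. \<mu> i). 1 \<le> m" if "i < n" for i
    using ge_1 that by (subst AE_distr_iff) (auto elim!: eventually_mono)
  then have "AE m in average_marginal n \<pi>. 1 \<le> m"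
    unfolding average_marginal_def using n
    by (subst AE_measure_pmf_bind_iff[where N = borel])
      (auto simp: coordinate_marginal_in_prob_algebra[OF \<pi>_prob] AE_measure_pmf_iff lessThan_empty_iff)
  moreover have "(\<integral>\<^sup>+m. ennreal (ln m powr p) \<partial>average_marginal n \<pi>)
      = (\<integral>\<^sup>+\<mu>. ennreal (1 / real n * (\<Sum>i<n. ln (\<mu> i) powr p)) \<partial>\<pi>)"
    by (subst nn_integral_average_marginal[OF \<pi>_prob n], measurable) (subst nn_integral_scaled_sum, auto)
  moreover have "average_marginal n \<pi> \<in> space (prob_algebra borel)"
    unfolding average_marginal_def
    by (intro measure_pmf_bind_in_prob_algebra coordinate_marginal_in_prob_algebra[OF \<pi>_prob])
  ultimately show ?thesis
    using moment by (simp add: prior_class1_iff)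
qed

lemma bayes_risk_coordinatewise:
  assumes \<pi>: "\<pi> \<in> prior_class n p \<eta>" and n: "1 \<le> n" and \<delta>: "\<delta> \<in> estimators1"
  shows "bayes_risk n (\<lambda>x i. \<delta> (x i)) \<pi> = bayes_risk1 \<delta> (average_marginal n \<pi>)"
proof -
  have \<pi>_prob: "\<pi> \<in> space (prob_algebra (\<Pi>\<^sub>M i\<in>{..<n}. borel))"
    and ge_1: "AE \<mu> in \<pi>. \<forall>i<n. 1 \<le> \<mu> i"
    using \<pi> by (simp_all add: prior_class_iff)
  then have sets_\<pi>: "sets \<pi> = sets (\<Pi>\<^sub>M i\<in>{..<n}. borel)"
    by (simp add: space_prob_algebra)
  have [measurable]: "\<delta> \<in> borel_measurable borel"
    using \<delta> by (simp add: estimators1_def)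
  have markov: "AE \<mu> in \<pi>. \<forall>j\<in>{..<n}. prob_space (exp_law (\<mu> j))"
    using ge_1 by eventually_elim (auto intro!: prob_space_exp_law intro: less_le_trans[OF zero_less_one])
  have "bayes_risk n (\<lambda>x i. \<delta> (x i)) \<pi>
      = ennreal (1 / real n) * (\<Sum>i<n. exp_mean.component_risk {..<n} i (\<lambda>x. ln (\<delta> (x i))) \<pi>)"
    by (rule bayes_risk_eq_average_component_risk[OF sets_\<pi> coordinatewise_in_estimators[OF \<delta>]])
  also have "\<dots> = ennreal (1 / real n)
      * (\<Sum>i<n. \<integral>\<^sup>+\<mu>. \<integral>\<^sup>+y. ennreal ((ln (\<delta> y) - ln (\<mu> i))\<^sup>2) \<partial>exp_law (\<mu> i) \<partial>\<pi>)"
    using sets_\<pi> markov by (simp add: exp_mean.component_risk_coordinate[where t = "\<lambda>y. ln (\<delta> y)"])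
  also have "\<dots> = bayes_risk1 \<delta> (average_marginal n \<pi>)"
    unfolding bayes_risk1_def
    by (rule nn_integral_average_marginal[OF \<pi>_prob n, symmetric])
      (rule nn_integral_measurable_subprob_algebra2[OF _ exp_law_kernel], measurable)
  finally show ?thesis .
qed

lemma minimax_bayes_risk_le_rho_bar:
  assumes "1 \<le> n"
  shows "minimax_bayes_risk n p \<eta> \<le> rho_bar p \<eta>"
  unfolding rho_bar_def minimax_bayes_risk_def
proof (rule INF_mono)
  fix \<delta> assume \<delta>: "\<delta> \<in> estimators1"
  show "\<exists>\<delta>'\<in>estimators n. (SUP \<pi>\<in>prior_class n p \<eta>. bayes_risk n \<delta>' \<pi>)
      \<le> (SUP F\<in>prior_class1 p \<eta>. bayes_risk1 \<delta> F)"
  proof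
    show "(\<lambda>x i. \<delta> (x i)) \<in> estimators n"
      using \<delta> by (rule coordinatewise_in_estimators)
    show "(SUP \<pi>\<in>prior_class n p \<eta>. bayes_risk n (\<lambda>x i. \<delta> (x i)) \<pi>)
      \<le> (SUP F\<in>prior_class1 p \<eta>. bayes_risk1 \<delta> F)"
      by (intro SUP_mono)
        (metis average_marginal_in_prior_class1 bayes_risk_coordinatewise assms \<delta> order_refl)
  qed
qed

lemma product_prior_in_prior_class:
  assumes F: "F \<in> prior_class1 p \<eta>" and n: "1 \<le> n"
  shows "(\<Pi>\<^sub>M i\<in>{..<n}. F) \<in> prior_class n p \<eta>"
proof -
  have F_prob: "prob_space F" and ge_1: "AE m in F. 1 \<le> m"
    and sets_F [measurable_cong]: "sets F = sets borel"
    and moment: "(\<integral>\<^sup>+m. ennreal (ln m powr p) \<partial>F) \<le> ennreal (\<eta> powr p)"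
    using F by (simp_all add: prior_class1_def)
  let ?P = "\<Pi>\<^sub>M i\<in>{..<n}. F"
  have "(\<integral>\<^sup>+\<mu>. ennreal (1 / real n * (\<Sum>i<n. ln (\<mu> i) powr p)) \<partial>?P)
    = ennreal (1 / real n) * (\<Sum>i<n. \<integral>\<^sup>+\<mu>. ennreal (ln (\<mu> i) powr p) \<partial>?P)"
    by (rule nn_integral_scaled_sum) auto
  also have "(\<Sum>i<n. \<integral>\<^sup>+\<mu>. ennreal (ln (\<mu> i) powr p) \<partial>?P) = (\<Sum>i<n. \<integral>\<^sup>+m. ennreal (ln m powr p) \<partial>F)"
    using F_prob
    by (intro sum.cong refl nn_integral_PiM_component[where f = "\<lambda>m. ennreal (ln m powr p)"]) auto
  also have "ennreal (1 / real n) * \<dots> = (\<integral>\<^sup>+m. ennreal (ln m powr p) \<partial>F)"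
    using n by (simp add: ennreal_of_nat_eq_real_of_nat mult.assoc[symmetric] flip: ennreal_mult)
  also note moment
  finally have "(\<integral>\<^sup>+\<mu>. ennreal (1 / real n * (\<Sum>i<n. ln (\<mu> i) powr p)) \<partial>?P) \<le> ennreal (\<eta> powr p)" .
  moreover have "AE \<mu> in ?P. \<forall>i\<in>{..<n}. 1 \<le> \<mu> i"
    by (intro AE_ball_countable[THEN iffD2] ballI AE_PiM_component F_prob ge_1) auto
  moreover have "sets ?P = sets (\<Pi>\<^sub>M i\<in>{..<n}. borel)"
    by (rule sets_PiM_cong) (simp_all add: sets_F)
  ultimately show ?thesis
    using prob_space_PiM[of "{..<n}" "\<lambda>_. F", OF F_prob] by (simp add: prior_class_def Ball_def)
qed

lemma bayes_value_le_product_risk: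
  assumes F: "F \<in> space (prob_algebra borel)" and ge_1: "AE m in F. 1 \<le> m"
    and n: "1 \<le> n" and \<delta>: "\<delta> \<in> estimators n"
  shows "exp_mean.bayes_value F \<le> bayes_risk n \<delta> (\<Pi>\<^sub>M i\<in>{..<n}. F)"
proof -
  have markov: "AE m in F. prob_space (exp_law m)"
    using ge_1 by eventually_elim (simp add: prob_space_exp_law)
  have component: "exp_mean.bayes_value F
      \<le> exp_mean.component_risk {..<n} i (\<lambda>x. ln (\<delta> x i)) (\<Pi>\<^sub>M i\<in>{..<n}. F)" if "i \<in> {..<n}" for i
    using that \<delta>
    by (intro exp_mean.bayes_value_le_component_risk F markov measurable_ln_estimator) simp_all
  have "exp_mean.bayes_value F = ennreal (1 / real n) * ennreal (real n) * exp_mean.bayes_value F"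
    using n by (simp flip: ennreal_mult)
  also have "\<dots> = ennreal (1 / real n) * (\<Sum>i<n. exp_mean.bayes_value F)"
    by (simp add: ennreal_of_nat_eq_real_of_nat mult.assoc)
  also have "\<dots> \<le> ennreal (1 / real n)
      * (\<Sum>i<n. exp_mean.component_risk {..<n} i (\<lambda>x. ln (\<delta> x i)) (\<Pi>\<^sub>M i\<in>{..<n}. F))"
    by (intro mult_left_mono sum_mono component) auto
  also have "\<dots> = bayes_risk n \<delta> (\<Pi>\<^sub>M i\<in>{..<n}. F)"
    using F
    by (intro bayes_risk_eq_average_component_risk[OF _ \<delta>, symmetric] sets_PiM_cong refl)
      (simp add: space_prob_algebra)
  finally show ?thesis .
qed

lemma SUP_bayes_value_le_minimax_bayes_risk:
  assumes "1 \<le> n"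
  shows "(SUP F\<in>prior_class1 p \<eta>. exp_mean.bayes_value F) \<le> minimax_bayes_risk n p \<eta>"
  unfolding minimax_bayes_risk_def
proof (intro INF_greatest SUP_least)
  fix \<delta> F assume "\<delta> \<in> estimators n" "F \<in> prior_class1 p \<eta>"
  then show "exp_mean.bayes_value F \<le> (SUP \<pi>\<in>prior_class n p \<eta>. bayes_risk n \<delta> \<pi>)"
    using assms by (intro SUP_upper2[where i = "\<Pi>\<^sub>M i\<in>{..<n}. F"]
        product_prior_in_prior_class bayes_value_le_product_risk) (simp_all add: prior_class1_iff)
qed

theorem theorem2p2:
  fixes p \<eta> :: real and n :: nat
  assumes "0 < p" and "p < 2" and "0 < \<eta>" and "1 \<le> n"
  shows "minimax_bayes_risk n p \<eta> = rho_bar p \<eta>"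
proof (rule antisym)
  show "minimax_bayes_risk n p \<eta> \<le> rho_bar p \<eta>"
    using \<open>1 \<le> n\<close> by (rule minimax_bayes_risk_le_rho_bar)
  have "rho_bar p \<eta> = (SUP F\<in>prior_class1 p \<eta>. exp_mean.bayes_value F)"
    using \<open>0 < p\<close> \<open>0 < \<eta>\<close> by (rule rho_bar_eq_SUP_bayes_value)
  also have "\<dots> \<le> minimax_bayes_risk n p \<eta>"
    using \<open>1 \<le> n\<close> by (rule SUP_bayes_value_le_minimax_bayes_risk)
  finally show "rho_bar p \<eta> \<le> minimax_bayes_risk n p \<eta>" .
qed

end
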